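(* Let $m,n$ be positive integers with $mn>6$. For every entangled state $\rho$ on $\mathbb{C}^m\otimes\mathbb{C}^n$ there exists a nondecomposable entanglement witness $W$ on $\mathbb{C}^m\otimes\mathbb{C}^n$ with $\operatorname{tr}(W\rho)<0$.
   Context: A state is a positive semidefinite trace-one matrix; it is separable if it is a convex combination of product states $|v\rangle\langle v|\otimes|w\rangle\langle w|$, and entangled otherwise. The partial transpose is $M^\Gamma:=(T\otimes\mathrm{id})(M)$ with $T$ the transpose on the first factor. A Hermitian $W$ is an entanglement witness if $\langle a,b|W|a,b\rangle\ge0$ for all product vectors $|a\rangle\otimes|b\rangle$ and $W$ has at least one negative eigenvalue; it is decomposable if $W=P+Q^\Gamma$ with $P,Q$ positive semidefinite, and nondecomposable otherwise. *)

theory Defs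
  imports "Jordan_Normal_Form.Jordan_Normal_Form"
begin

text \<open>Bipartite system C^m (x) C^n, realised as C^(m*n); the basis vector
  e_a (x) e_b (a < m, b < n) has index a*n + b.  Matrices are JNF matrices
  of dimension (m*n) x (m*n).\<close>

definition hermitian :: "nat \<Rightarrow> complex mat \<Rightarrow> bool" where
  "hermitian N A \<longleftrightarrow> A \<in> carrier_mat N N \<and>
     (\<forall>i<N. \<forall>j<N. A $$ (i, j) = cnj (A $$ (j, i)))"

definition psd :: "nat \<Rightarrow> complex mat \<Rightarrow> bool" where
  "psd N A \<longleftrightarrow> hermitian N A \<and>
     (\<forall>x \<in> carrier_vec N. 0 \<le> Re ((A *\<^sub>v x) \<bullet>c x))"

definition mtrace :: "complex mat \<Rightarrow> complex" where
  "mtrace A = (\<Sum>i<dim_row A. A $$ (i, i))"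

definition is_state :: "nat \<Rightarrow> complex mat \<Rightarrow> bool" where
  "is_state N \<rho> \<longleftrightarrow> psd N \<rho> \<and> mtrace \<rho> = 1"

definition tensor_vec :: "nat \<Rightarrow> nat \<Rightarrow> complex vec \<Rightarrow> complex vec \<Rightarrow> complex vec" where
  "tensor_vec m n v w = vec (m * n) (\<lambda>i. v $ (i div n) * w $ (i mod n))"

definition ketbra :: "complex vec \<Rightarrow> complex mat" where
  "ketbra x = mat (dim_vec x) (dim_vec x) (\<lambda>(i, j). x $ i * cnj (x $ j))"

definition unit_vec_in :: "nat \<Rightarrow> complex vec \<Rightarrow> bool" where
  "unit_vec_in d v \<longleftrightarrow> v \<in> carrier_vec d \<and> v \<bullet>c v = 1"

text \<open>Separable: a (finite) convex combination of product states
  |v><v| (x) |w><w| = |v (x) w><v (x) w| with unit vectors v, w.\<close>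
definition separable :: "nat \<Rightarrow> nat \<Rightarrow> complex mat \<Rightarrow> bool" where
  "separable m n \<rho> \<longleftrightarrow>
     (\<exists>(k::nat) (p::nat \<Rightarrow> real) (v::nat \<Rightarrow> complex vec) (w::nat \<Rightarrow> complex vec).
        (\<forall>l<k. 0 \<le> p l \<and> unit_vec_in m (v l) \<and> unit_vec_in n (w l)) \<and>
        (\<Sum>l<k. p l) = 1 \<and>
        \<rho> \<in> carrier_mat (m * n) (m * n) \<and>
        (\<forall>i < m * n. \<forall>j < m * n.
           \<rho> $$ (i, j) = (\<Sum>l<k. complex_of_real (p l) * ketbra (tensor_vec m n (v l) (w l)) $$ (i, j))))"

definition entangled :: "nat \<Rightarrow> nat \<Rightarrow> complex mat \<Rightarrow> bool" where
  "entangled m n \<rho> \<longleftrightarrow> is_state (m * n) \<rho> \<and> \<not> separable m n \<rho>"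

text \<open>Partial transpose (T (x) id): the entry at ((a,b),(a',b')) of M^Gamma
  is the entry of M at ((a',b),(a,b')).\<close>
definition ptrans :: "nat \<Rightarrow> nat \<Rightarrow> complex mat \<Rightarrow> complex mat" where
  "ptrans m n M = mat (m * n) (m * n)
     (\<lambda>(i, j). M $$ ((j div n) * n + i mod n, (i div n) * n + j mod n))"

definition entanglement_witness :: "nat \<Rightarrow> nat \<Rightarrow> complex mat \<Rightarrow> bool" where
  "entanglement_witness m n W \<longleftrightarrow> hermitian (m * n) W \<and>
     (\<forall>a \<in> carrier_vec m. \<forall>b \<in> carrier_vec n.
        0 \<le> Re ((W *\<^sub>v tensor_vec m n a b) \<bullet>c tensor_vec m n a b)) \<and>
     (\<exists>r::real. r < 0 \<and> eigenvalue W (complex_of_real r))"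

definition decomposable :: "nat \<Rightarrow> nat \<Rightarrow> complex mat \<Rightarrow> bool" where
  "decomposable m n W \<longleftrightarrow>
     (\<exists>P Q. psd (m * n) P \<and> psd (m * n) Q \<and> W = P + ptrans m n Q)"

end

theory Submission
  imports "HOL-Analysis.Topology_Euclidean_Space" "HOL-Analysis.Function_Topology"
    "Jordan_Normal_Form.Spectral_Radius" Defs
begin

text \<open>The separable cone is closed, so the point of it nearest to an entangled \<open>X\<close> yields a witness
  for \<open>X\<close>. If the partial transpose of \<open>X\<close> is positive, every witness for \<open>X\<close> is nondecomposable.
  Otherwise some \<open>\<psi>\<close> satisfies \<open>\<langle>\<psi>|X\<^sup>\<Gamma>|\<psi>\<rangle> < 0\<close>, and this survives a small perturbation of \<open>\<psi>\<close>. For a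
  generic \<open>\<psi>\<close> there is an entangled \<open>Y\<close> with positive partial transpose and \<open>\<langle>\<psi>|Y\<^sup>\<Gamma>|\<psi>\<rangle> = 0\<close>, obtained
  from one \<open>3 \<times> 3\<close> and one \<open>2 \<times> 4\<close> example by a change of basis. If \<open>W\<close> is a witness for \<open>Y\<close>, then
  \<open>(|\<psi>\<rangle>\<langle>\<psi>|)\<^sup>\<Gamma> + \<epsilon> W\<close> is negative on \<open>X\<close> for small \<open>\<epsilon> > 0\<close>, and negative on \<open>Y\<close>, which makes it
  nondecomposable.\<close>

section \<open>Hermitian forms on a finite index set\<close>

text \<open>A decomposable operator pairs nonnegatively with every positive \<open>Y\<close> whose
  partial transpose is positive, since tr((P + Q^Gamma) Y) = tr(P Y) + tr(Q Y^Gamma). The obstacle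
  is an \<open>X\<close> whose partial transpose is not positive: the obvious witness, the partial
  transpose of |\<psi>><\<psi>|, is decomposable. It has to be tilted towards a witness for some
  \<open>Y\<close>, but so little that it stays negative on \<open>X\<close>. An arbitrarily small
  tilt suffices if the untilted operator vanishes on \<open>Y\<close>; hence the condition on \<psi>
  and the partial transpose of \<open>Y\<close>. A change of basis in the second factor commutes
  with transposing the first. So one example per size is enough, arranged so that its partial
  transpose annihilates the sum of |a,a> over a < r, with r = 3 or r = 2. In terms of coefficient
  matrices this is tracelessness. When both dimensions are at least 2, mn > 6 leaves room for 3 x 3
  or 2 x 4, up to exchanging the factors.\<close>

definition sform :: "'i set \<Rightarrow> ('i \<Rightarrow> 'i \<Rightarrow> complex) \<Rightarrow> ('i \<Rightarrow> complex) \<Rightarrow> ('i \<Rightarrow> complex) \<Rightarrow> complex" where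
  "sform I A x y = (\<Sum>i\<in>I. \<Sum>j\<in>I. cnj (x i) * A i j * y j)"

definition herm_on :: "'i set \<Rightarrow> ('i \<Rightarrow> 'i \<Rightarrow> complex) \<Rightarrow> bool" where
  "herm_on I A \<longleftrightarrow> (\<forall>i\<in>I. \<forall>j\<in>I. A i j = cnj (A j i))"

definition psd_on :: "'i set \<Rightarrow> ('i \<Rightarrow> 'i \<Rightarrow> complex) \<Rightarrow> bool" where
  "psd_on I A \<longleftrightarrow> herm_on I A \<and> (\<forall>x. 0 \<le> Re (sform I A x x))"

lemma herm_onD: "herm_on I A \<Longrightarrow> i \<in> I \<Longrightarrow> j \<in> I \<Longrightarrow> cnj (A j i) = A i j"
  unfolding herm_on_def by metis

lemma herm_onD': "herm_on I A \<Longrightarrow> i \<in> I \<Longrightarrow> j \<in> I \<Longrightarrow> cnj (A i j) = A j i"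
  unfolding herm_on_def by metis

lemma sform_cong:
  assumes "\<And>i j. i \<in> I \<Longrightarrow> j \<in> I \<Longrightarrow> A i j = B i j"
    and "\<And>i. i \<in> I \<Longrightarrow> x i = x' i" and "\<And>i. i \<in> I \<Longrightarrow> y i = y' i"
  shows "sform I A x y = sform I B x' y'"
  unfolding sform_def using assms by (intro sum.cong refl) auto

lemma sform_cnj:
  assumes "herm_on I A"
  shows "sform I A y x = cnj (sform I A x y)"
  unfolding sform_def cnj_sum
  by (subst sum.swap) (auto intro!: sum.cong simp: herm_onD'[OF assms] ac_simps)

lemma sform_add_left: "sform I A (\<lambda>i. x i + y i) z = sform I A x z + sform I A y z"
  by (simp add: sform_def algebra_simps sum.distrib)

lemma sform_add_right: "sform I A z (\<lambda>i. x i + y i) = sform I A z x + sform I A z y"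
  by (simp add: sform_def algebra_simps sum.distrib)

lemma sform_scale_left: "sform I A (\<lambda>i. c * x i) z = cnj c * sform I A x z"
  by (simp add: sform_def algebra_simps sum_distrib_left)

lemma sform_scale_right: "sform I A z (\<lambda>i. c * x i) = c * sform I A z x"
  by (simp add: sform_def algebra_simps sum_distrib_left)

lemma sform_add_mat: "sform I (\<lambda>i j. A i j + B i j) x y = sform I A x y + sform I B x y"
  by (simp add: sform_def algebra_simps sum.distrib)

lemma sform_diff_mat: "sform I (\<lambda>i j. A i j - B i j) x y = sform I A x y - sform I B x y"
  by (simp add: sform_def algebra_simps sum_subtractf)

lemma sform_scale_mat: "sform I (\<lambda>i j. c * A i j) x y = c * sform I A x y"
  by (simp add: sform_def algebra_simps sum_distrib_left)

lemma sform_ketbra: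
  "sform I (\<lambda>i j. v i * cnj (w j)) x y = (\<Sum>i\<in>I. cnj (x i) * v i) * (\<Sum>i\<in>I. cnj (w i) * y i)"
  by (simp add: sform_def sum_product algebra_simps)

lemma sform_sum_mat:
  "sform I (\<lambda>i j. \<Sum>l\<in>L. A l i j) x y = (\<Sum>l\<in>L. sform I (A l) x y)"
proof -
  have "sform I (\<lambda>i j. \<Sum>l\<in>L. A l i j) x y = (\<Sum>i\<in>I. \<Sum>l\<in>L. \<Sum>j\<in>I. cnj (x i) * A l i j * y j)"
    unfolding sform_def sum_distrib_left sum_distrib_right
    by (intro sum.cong refl) (rule sum.swap)
  also have "\<dots> = (\<Sum>l\<in>L. sform I (A l) x y)"
    unfolding sform_def by (rule sum.swap)
  finally show ?thesis .
qed

lemma mult_cnj_norm: "cnj z * z = complex_of_real ((cmod z)\<^sup>2)"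
  using complex_norm_square[of z] by (simp add: mult.commute)

lemma cnj_sum_form: "(\<Sum>i\<in>I. cnj (x i) * v i) * (\<Sum>i\<in>I. cnj (v i) * x i)
    = complex_of_real ((cmod (\<Sum>i\<in>I. cnj (x i) * v i))\<^sup>2)"
proof -
  have "(\<Sum>i\<in>I. cnj (v i) * x i) = cnj (\<Sum>i\<in>I. cnj (x i) * v i)"
    by (simp add: mult.commute)
  then show ?thesis
    by (metis mult_cnj_norm mult.commute)
qed

lemma sform_ketbra_self:
  "sform I (\<lambda>i j. v i * cnj (v j)) x x = complex_of_real ((cmod (\<Sum>i\<in>I. cnj (x i) * v i))\<^sup>2)"
  by (simp add: sform_ketbra cnj_sum_form)

lemma sform_gram:
  "sform I (\<lambda>i j. \<Sum>l\<in>L. v l i * cnj (v l j)) x x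
    = complex_of_real (\<Sum>l\<in>L. (cmod (\<Sum>i\<in>I. cnj (x i) * v l i))\<^sup>2)"
  by (simp add: sform_sum_mat sform_ketbra_self)

lemma psd_on_gram: "psd_on I (\<lambda>i j. \<Sum>l\<in>L. v l i * cnj (v l j))"
  by (auto simp: psd_on_def herm_on_def sform_gram mult.commute simp del: of_real_sum of_real_power intro: sum_nonneg)

lemma quadratic_nonneg_imp_linear_zero:
  fixes b c :: real
  assumes "\<And>t. 0 \<le> 2 * t * b + t\<^sup>2 * c"
  shows "b = 0"
proof (rule ccontr)
  assume b: "b \<noteq> 0"
  define d where "d = \<bar>c\<bar> + 1"
  have d: "d > 0" "c < d" by (auto simp: d_def)
  have "0 \<le> 2 * (- b / d) * b + (- b / d)\<^sup>2 * c" by (rule assms)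
  also have "\<dots> \<le> 2 * (- b / d) * b + (- b / d)\<^sup>2 * d"
    using d by (intro add_left_mono mult_left_mono) auto
  also have "\<dots> = - (b\<^sup>2 / d)"
    using d by (simp add: field_simps power2_eq_square)
  also have "\<dots> < 0" using b d by simp
  finally show False by simp
qed

text \<open>Cauchy-Schwarz for a degenerate form: along x + t y the form is 2 t b + t^2 c, and
  nonnegativity for both signs of t forces b = 0. Replacing y by its multiple with the imaginary
  unit settles the imaginary part.\<close>

lemma psd_on_isotropic:
  assumes A: "psd_on I A" and x: "Re (sform I A x x) = 0"
  shows "sform I A y x = 0"
proof -
  have H: "herm_on I A" using A by (simp add: psd_on_def)
  have Re0: "Re (sform I A y x) = 0" for y
  proof (rule quadratic_nonneg_imp_linear_zero)
    fix t :: real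
    have "sform I A (\<lambda>i. x i + of_real t * y i) (\<lambda>i. x i + of_real t * y i)
      = sform I A x x + t * (sform I A y x + cnj (sform I A y x)) + t\<^sup>2 * sform I A y y"
      by (simp add: sform_add_left sform_add_right sform_scale_left sform_scale_right
          sform_cnj[OF H, of x y] algebra_simps power2_eq_square)
    moreover have "0 \<le> Re (sform I A (\<lambda>i. x i + of_real t * y i) (\<lambda>i. x i + of_real t * y i))"
      using A by (simp add: psd_on_def)
    ultimately show "0 \<le> 2 * t * Re (sform I A y x) + t\<^sup>2 * Re (sform I A y y)"
      using x by (simp add: power2_eq_square)
  qed
  have "Re (sform I A (\<lambda>i. \<i> * y i) x) = Im (sform I A y x)"
    by (simp add: sform_scale_left)
  then have "Im (sform I A y x) = 0" using Re0 by simp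
  then show ?thesis using Re0 by (simp add: complex_eq_iff)
qed

lemma sform_unit_left:
  assumes "finite I" "i \<in> I"
  shows "sform I A (\<lambda>k. if k = i then 1 else 0) x = (\<Sum>j\<in>I. A i j * x j)"
  using assms unfolding sform_def
  by (subst sum.remove[of _ i]) (auto intro!: sum.neutral)

lemma psd_on_isotropic_kernel:
  assumes "psd_on I A" "Re (sform I A x x) = 0" "finite I" "i \<in> I"
  shows "(\<Sum>j\<in>I. A i j * x j) = 0"
  using psd_on_isotropic[OF assms(1,2)] sform_unit_left[OF assms(3,4)] by metis

lemma sform_insert:
  assumes "finite I" "p \<notin> I"
  shows "sform (insert p I) A x y = sform I A x y + cnj (x p) * (\<Sum>j\<in>I. A p j * y j)
    + (\<Sum>i\<in>I. cnj (x i) * A i p) * y p + cnj (x p) * A p p * y p"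
  using assms
  by (simp add: sform_def sum.distrib sum_distrib_left sum_distrib_right algebra_simps)

lemma psd_on_subset:
  assumes A: "psd_on J A" and J: "finite J" "I \<subseteq> J"
  shows "psd_on I A"
proof -
  have "sform I A x x = sform J A (\<lambda>i. if i \<in> I then x i else 0) (\<lambda>i. if i \<in> I then x i else 0)" for x
    unfolding sform_def using J
    by (intro sum.mono_neutral_cong_left) (auto intro!: sum.mono_neutral_cong_left simp: finite_subset)
  then show ?thesis
    using A J unfolding psd_on_def herm_on_def by (metis subsetD)
qed

lemma psd_on_diag:
  assumes A: "psd_on I A" "finite I" "p \<in> I"
  shows "A p p = of_real (Re (A p p))" "0 \<le> Re (A p p)"
proof -
  have "psd_on {p} A" using psd_on_subset[OF A(1,2), of "{p}"] A(3) by simp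
  then have *: "0 \<le> Re (sform {p} A (\<lambda>_. 1) (\<lambda>_. 1))" "cnj (A p p) = A p p"
    unfolding psd_on_def herm_on_def by (blast, metis insertI1)
  show "0 \<le> Re (A p p)" using *(1) by (simp add: sform_def)
  have "Im (A p p) = 0" using arg_cong[OF *(2), of Im] by simp
  then show "A p p = of_real (Re (A p p))" by (simp add: complex_eq_iff)
qed

lemma psd_on_schur:
  assumes A: "psd_on (insert p I) A" and I: "finite I" "p \<notin> I" and pos: "A p p = of_real \<alpha>" "\<alpha> > 0"
  shows "psd_on I (\<lambda>i j. A i j - A i p * cnj (A j p) / of_real \<alpha>)"
proof -
  let ?B = "\<lambda>i j. A i j - A i p * cnj (A j p) / of_real \<alpha>"
  have H: "herm_on (insert p I) A" using A by (simp add: psd_on_def)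
  have Aip: "A p j = cnj (A j p)" if "j \<in> I" for j
    using H that unfolding herm_on_def by blast
  have "herm_on I ?B"
    unfolding herm_on_def using herm_onD[OF H] by simp
  moreover have "0 \<le> Re (sform I ?B x x)" for x
  proof -
    define \<beta> where "\<beta> = (\<Sum>j\<in>I. A p j * x j)"
    \<comment> \<open>The coordinate at \<open>p\<close> that minimises the form for given
      coordinates in \<open>I\<close>, that is, completes the square.\<close>
    define y where "y = x(p := - \<beta> / of_real \<alpha>)"
    have yI: "y j = x j" if "j \<in> I" for j using that I by (auto simp: y_def)
    have 1: "(\<Sum>j\<in>I. A p j * y j) = \<beta>" by (simp add: \<beta>_def yI)
    have 2: "(\<Sum>i\<in>I. cnj (y i) * A i p) = cnj \<beta>"
      by (simp add: \<beta>_def yI Aip mult.commute)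
    have 3: "sform I A y y = sform I A x x" by (rule sform_cong) (auto simp: yI)
    have "sform (insert p I) A y y
      = sform I A x x + cnj (y p) * \<beta> + cnj \<beta> * y p + cnj (y p) * A p p * y p"
      by (simp add: sform_insert I 1 2 3)
    also have "\<dots> = sform I A x x - cnj \<beta> * \<beta> / of_real \<alpha>"
      using pos by (simp add: y_def field_simps)
    also have "cnj \<beta> * \<beta> / of_real \<alpha> = sform I (\<lambda>i j. A i p * cnj (A j p) / of_real \<alpha>) x x"
    proof -
      have "sform I (\<lambda>i j. A i p * cnj (A j p) / of_real \<alpha>) x x
        = sform I (\<lambda>i j. inverse (of_real \<alpha>) * (A i p * cnj (A j p))) x x"
        by (simp add: field_simps)
      also have "\<dots> = inverse (of_real \<alpha>) * ((\<Sum>i\<in>I. cnj (x i) * A i p) * (\<Sum>i\<in>I. cnj (A i p) * x i))"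
        by (simp only: sform_scale_mat sform_ketbra)
      also have "(\<Sum>i\<in>I. cnj (x i) * A i p) = cnj \<beta>" using 2 by (simp add: yI)
      also have "(\<Sum>i\<in>I. cnj (A i p) * x i) = \<beta>" by (simp add: \<beta>_def Aip)
      finally show ?thesis by (simp add: field_simps)
    qed
    also have "sform I A x x - sform I (\<lambda>i j. A i p * cnj (A j p) / of_real \<alpha>) x x = sform I ?B x x"
      by (simp add: sform_diff_mat)
    finally show ?thesis using A by (metis psd_on_def)
  qed
  ultimately show ?thesis by (simp add: psd_on_def)
qed

text \<open>Cholesky factorisation: a positive pivot splits off the rank one term of its column and
  leaves the Schur complement; a zero pivot makes its row and column vanish, because its unit vector
  is isotropic.\<close>

lemma psd_on_gram_decomposition:
  assumes "finite I" "psd_on I A"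
  shows "\<exists>(k::nat) v. \<forall>i\<in>I. \<forall>j\<in>I. A i j = (\<Sum>l<k. v l i * cnj (v l j))"
  using assms
proof (induction I arbitrary: A rule: finite_induct)
  case empty
  then show ?case by simp
next
  case (insert p I)
  have H: "herm_on (insert p I) A" using insert by (simp add: psd_on_def)
  have ne: "i \<noteq> p" if "i \<in> I" for i using that insert.hyps by blast
  define \<alpha> where "\<alpha> = Re (A p p)"
  have \<alpha>: "A p p = of_real \<alpha>" "\<alpha> \<ge> 0"
    using psd_on_diag[OF insert.prems] insert.hyps by (auto simp: \<alpha>_def)
  show ?case
  proof (cases "\<alpha> = 0")
    case True
    have 0: "A i p = 0" if "i \<in> insert p I" for i
    proof -
      let ?e = "\<lambda>k. if k = p then 1 else (0::complex)"
      have "sform (insert p I) A ?e ?e = 0"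
        using True \<alpha> insert.hyps by (subst sform_unit_left) (auto intro!: sum.neutral)
      then have "(\<Sum>j\<in>insert p I. A i j * ?e j) = 0"
        by (intro psd_on_isotropic_kernel[OF insert.prems]) (use that insert.hyps in auto)
      moreover have "(\<Sum>j\<in>insert p I. A i j * ?e j) = A i p"
        using insert.hyps by (auto intro!: sum.neutral)
      ultimately show ?thesis by simp
    qed
    have zr: "A p i = 0" if "i \<in> insert p I" for i
      using herm_onD[OF H, of p i] 0[OF that] that by simp
    have pI: "psd_on I A"
      by (rule psd_on_subset[OF insert.prems]) (use insert.hyps in auto)
    obtain k :: nat and v where v: "\<forall>i\<in>I. \<forall>j\<in>I. A i j = (\<Sum>l<k. v l i * cnj (v l j))"
      using insert.IH[OF pI] by blast
    have "\<forall>i\<in>insert p I. \<forall>j\<in>insert p I. A i j = (\<Sum>l<k. ((v l)(p := 0)) i * cnj (((v l)(p := 0)) j))"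
      using v 0 zr ne insert.hyps by auto
    then show ?thesis by (intro exI[of _ k] exI[of _ "\<lambda>l. (v l)(p := 0)"])
  next
    case False
    with \<alpha> have pos: "\<alpha> > 0" by simp
    obtain k :: nat and v where v: "\<forall>i\<in>I. \<forall>j\<in>I.
        A i j - A i p * cnj (A j p) / of_real \<alpha> = (\<Sum>l<k. v l i * cnj (v l j))"
      using insert.IH[OF psd_on_schur[OF insert.prems insert.hyps \<alpha>(1) pos]]
      by blast
    define w where "w l = (if l < k then (v l)(p := 0) else (\<lambda>i. A i p / of_real (sqrt \<alpha>)))" for l
    have s: "complex_of_real (sqrt \<alpha>) * complex_of_real (sqrt \<alpha>) = of_real \<alpha>"
      using pos by (metis of_real_mult real_sqrt_mult_self abs_of_pos)
    have "A i j = (\<Sum>l<Suc k. w l i * cnj (w l j))" if ij: "i \<in> insert p I" "j \<in> insert p I" for i j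
    proof -
      have "(\<Sum>l<Suc k. w l i * cnj (w l j))
        = (\<Sum>l<k. ((v l)(p := 0)) i * cnj (((v l)(p := 0)) j)) + A i p * cnj (A j p) / of_real \<alpha>"
        using s by (simp add: w_def)
      moreover have "(\<Sum>l<k. ((v l)(p := 0)) i * cnj (((v l)(p := 0)) j))
         = A i j - A i p * cnj (A j p) / of_real \<alpha>"
      proof (cases "i = p \<or> j = p")
        case True
        then show ?thesis using \<alpha>(1) pos herm_onD[OF H, of p j] ij by auto
      next
        case False
        then show ?thesis using v ij ne by auto
      qed
      ultimately show ?thesis by simp
    qed
    then have "\<forall>i\<in>insert p I. \<forall>j\<in>insert p I. A i j = (\<Sum>l<Suc k. w l i * cnj (w l j))" by blast
    then show ?thesis by (intro exI)
  qed
qed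

section \<open>The trace pairing\<close>

definition tr_prod :: "'i set \<Rightarrow> ('i \<Rightarrow> 'i \<Rightarrow> complex) \<Rightarrow> ('i \<Rightarrow> 'i \<Rightarrow> complex) \<Rightarrow> complex" where
  "tr_prod I A B = (\<Sum>i\<in>I. \<Sum>j\<in>I. A i j * B j i)"

lemma tr_prod_gram:
  assumes "\<And>i j. i \<in> I \<Longrightarrow> j \<in> I \<Longrightarrow> B i j = (\<Sum>l\<in>L. v l i * cnj (v l j))"
  shows "tr_prod I A B = (\<Sum>l\<in>L. sform I A (v l) (v l))"
proof -
  have "tr_prod I A B = (\<Sum>i\<in>I. \<Sum>j\<in>I. \<Sum>l\<in>L. cnj (v l i) * A i j * v l j)"
    unfolding tr_prod_def by (simp add: assms sum_distrib_left ac_simps)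
  also have "\<dots> = (\<Sum>i\<in>I. \<Sum>l\<in>L. \<Sum>j\<in>I. cnj (v l i) * A i j * v l j)"
    by (intro sum.cong refl) (rule sum.swap)
  also have "\<dots> = (\<Sum>l\<in>L. sform I A (v l) (v l))"
    unfolding sform_def by (rule sum.swap)
  finally show ?thesis .
qed

text \<open>Writing \<open>B\<close> as a sum of ketbras turns the trace into a sum of values of the
  form \<open>A\<close>.\<close>

lemma tr_prod_psd_nonneg:
  assumes "finite I" "psd_on I A" "psd_on I B"
  shows "0 \<le> Re (tr_prod I A B)"
proof -
  obtain k :: nat and v where "\<forall>i\<in>I. \<forall>j\<in>I. B i j = (\<Sum>l<k. v l i * cnj (v l j))"
    using psd_on_gram_decomposition[OF assms(1,3)] by blast
  then have "tr_prod I A B = (\<Sum>l<k. sform I A (v l) (v l))"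
    by (intro tr_prod_gram) auto
  then show ?thesis using assms(2) by (simp add: psd_on_def sum_nonneg)
qed

lemma tr_prod_add_left: "tr_prod I (\<lambda>i j. A i j + B i j) C = tr_prod I A C + tr_prod I B C"
  by (simp add: tr_prod_def algebra_simps sum.distrib)

lemma tr_prod_scale_left: "tr_prod I (\<lambda>i j. c * A i j) C = c * tr_prod I A C"
  by (simp add: tr_prod_def algebra_simps sum_distrib_left)

section \<open>Compactness and the lowest eigenvalue\<close>

text \<open>Tychonoff's theorem; it allows vectors to remain total functions, even on an infinite
  index type.\<close>

lemma compact_functions_into:
  fixes K :: "'b::topological_space set"
  assumes "compact K"
  shows "compact {f :: 'a \<Rightarrow> 'b. \<forall>i. f i \<in> K}"
proof -
  have "compactin (product_topology (\<lambda>_::'a. euclidean) UNIV) (PiE UNIV (\<lambda>_. K))"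
    using assms by (subst compactin_PiE) auto
  moreover have "PiE UNIV (\<lambda>_. K) = {f :: 'a \<Rightarrow> 'b. \<forall>i. f i \<in> K}"
    by auto
  ultimately show ?thesis by (simp add: euclidean_product_topology)
qed

text \<open>The minimum of the Rayleigh quotient is an eigenvalue.\<close>
lemma negative_eigenvector:
  assumes I: "finite I" and H: "herm_on I A" and neg: "Re (sform I A z z) < 0"
  obtains r :: real and x where "r < 0" "\<exists>i\<in>I. x i \<noteq> 0"
    "\<And>i. i \<in> I \<Longrightarrow> (\<Sum>j\<in>I. A i j * x j) = of_real r * x i"
proof -
  define nsq where "nsq x = (\<Sum>i\<in>I. (cmod (x i))\<^sup>2)" for x
  define q where "q x = Re (sform I A x x)" for x
  \<comment> \<open>\<open>nsq\<close> sees only the coordinates in \<open>I\<close>; the unit ball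
    also bounds the others, so that \<open>S\<close> is compact.\<close>
  define S where "S = {x. \<forall>i. x i \<in> cball (0::complex) 1} \<inter> {x. nsq x = 1}"
  have cn: "continuous_on UNIV nsq" unfolding nsq_def
    by (intro continuous_intros continuous_on_product_coordinates)
  have cq: "continuous_on UNIV q" unfolding q_def sform_def
    by (intro continuous_intros continuous_on_product_coordinates)
  have "closed {x. nsq x = 1}"
    using closed_Collect_eq[OF cn continuous_on_const] by simp
  then have compS: "compact S"
    unfolding S_def by (intro compact_Int_closed compact_functions_into compact_cball)
  have scale: "q (\<lambda>i. of_real c * x i) = c\<^sup>2 * q x" for c x
    by (simp add: q_def sform_scale_left sform_scale_right power2_eq_square)
  have nscale: "nsq (\<lambda>i. of_real c * x i) = c\<^sup>2 * nsq x" for c x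
    by (simp add: nsq_def norm_mult power_mult_distrib sum_distrib_left)
  have norm0: "q x = 0" if "nsq x = 0" for x
  proof -
    have "\<forall>i\<in>I. x i = 0" using that I by (auto simp: nsq_def sum_nonneg_eq_0_iff)
    then show ?thesis by (simp add: q_def sform_def)
  qed
  have nn: "nsq x \<ge> 0" for x by (simp add: nsq_def sum_nonneg)
  have unit: "\<exists>y\<in>S. q x = nsq x * q y" if "nsq x \<noteq> 0" for x
  proof -
    define c where "c = 1 / sqrt (nsq x)"
    define y where "y i = (if i \<in> I then of_real c * x i else 0)" for i
    have pos: "nsq x > 0" using that nn[of x] by simp
    have "nsq y = nsq (\<lambda>i. of_real c * x i)" by (simp add: nsq_def y_def)
    also have "\<dots> = c\<^sup>2 * nsq x" by (rule nscale)
    also have "\<dots> = 1" using pos by (simp add: c_def power_divide)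
    finally have n1: "nsq y = 1" .
    have "cmod (y i) \<le> 1" for i
    proof (cases "i \<in> I")
      case True
      then have "(cmod (y i))\<^sup>2 \<le> nsq y" unfolding nsq_def
        using I by (intro member_le_sum) auto
      then show ?thesis using n1 by (simp add: power2_le_iff_abs_le abs_square_le_1)
    qed (simp add: y_def)
    then have "y \<in> S" using n1 by (simp add: S_def)
    moreover have "q y = q (\<lambda>i. of_real c * x i)"
      unfolding q_def by (intro arg_cong[of _ _ Re] sform_cong) (auto simp: y_def)
    then have "q y = c\<^sup>2 * q x" by (simp only: scale)
    then have "q y = q x / nsq x" using pos by (simp add: c_def power_divide)
    then have "q x = nsq x * q y" using pos by simp
    ultimately show ?thesis by blast
  qed
  have zn: "nsq z \<noteq> 0" using norm0[of z] neg by (auto simp: q_def)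
  then have "S \<noteq> {}" using unit by blast
  then obtain x where x: "x \<in> S" "\<And>y. y \<in> S \<Longrightarrow> q x \<le> q y"
    using continuous_attains_inf[OF compS _ continuous_on_subset[OF cq]] by auto
  define r where "r = q x"
  have nx: "nsq x = 1" using x by (simp add: S_def)
  have r: "r < 0"
  proof -
    obtain y where y: "y \<in> S" "q z = nsq z * q y" using unit[OF zn] by blast
    have "nsq z * q y < 0" using y(2) neg by (simp add: q_def)
    then have "q y < 0" using nn[of z] by (simp add: mult_less_0_iff)
    then show ?thesis using x(2)[OF y(1)] by (simp add: r_def)
  qed
  \<comment> \<open>By minimality of \<open>r\<close> the shifted form is nonnegative, and it
    vanishes at \<open>x\<close>; an isotropic vector of a positive form lies in the kernel.\<close>
  define B where "B = (\<lambda>i j. A i j - (if i = j then of_real r else 0))"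
  have B: "sform I B y y = sform I A y y - of_real (r * nsq y)" for y
  proof -
    have "sform I (\<lambda>i j. if i = j then complex_of_real r else 0) y y
        = (\<Sum>i\<in>I. cnj (y i) * of_real r * y i)"
      unfolding sform_def using I
      by (intro sum.cong refl) (simp add: if_distrib[of "\<lambda>u. _ * u * _"] cong: if_cong)
    also have "\<dots> = of_real (r * nsq y)"
      by (simp add: nsq_def sum_distrib_left mult_cnj_norm[symmetric] ac_simps del: of_real_power)
    finally show ?thesis by (simp add: B_def sform_diff_mat)
  qed
  have "herm_on I B"
    unfolding herm_on_def B_def using herm_onD[OF H] by simp
  moreover have "0 \<le> Re (sform I B y y)" for y
  proof (cases "nsq y = 0")
    case True
    then show ?thesis using norm0[of y] by (simp add: B q_def)
  next
    case False
    then obtain u where "u \<in> S" "q y = nsq y * q u" using unit by blast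
    then have "q y \<ge> nsq y * r" using x(2)[of u] nn[of y] by (simp add: r_def mult_left_mono)
    then show ?thesis by (simp add: B q_def mult.commute)
  qed
  ultimately have "psd_on I B" by (simp add: psd_on_def)
  moreover have "Re (sform I B x x) = 0" by (simp add: B nx r_def q_def)
  ultimately have k: "(\<Sum>j\<in>I. B i j * x j) = 0" if "i \<in> I" for i
    using I that by (rule psd_on_isotropic_kernel)
  have "(\<Sum>j\<in>I. A i j * x j) = of_real r * x i" if "i \<in> I" for i
  proof -
    have "(\<Sum>j\<in>I. B i j * x j) = (\<Sum>j\<in>I. A i j * x j) - (\<Sum>j\<in>I. (if i = j then of_real r else 0) * x j)"
      by (simp add: B_def left_diff_distrib sum_subtractf)
    also have "(\<Sum>j\<in>I. (if i = j then of_real r else 0) * x j) = of_real r * x i"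
      using I that by (simp add: if_distrib[of "\<lambda>u. u * _"] cong: if_cong)
    finally show ?thesis using k[OF that] by simp
  qed
  moreover have "\<exists>i\<in>I. x i \<noteq> 0"
  proof (rule ccontr)
    assume "\<not> (\<exists>i\<in>I. x i \<noteq> 0)"
    then have "nsq x = 0" by (simp add: nsq_def)
    then show False using nx by simp
  qed
  ultimately show ?thesis using r that by blast
qed

section \<open>Caratheodory's theorem for cones\<close>

lemma linear_dependence:
  fixes a :: "'k \<Rightarrow> 'l \<Rightarrow> real"
  assumes "finite K" "finite L" "card K < card L"
  shows "\<exists>c. (\<exists>l\<in>L. c l \<noteq> 0) \<and> (\<forall>k\<in>K. (\<Sum>l\<in>L. c l * a k l) = 0)"
  using assms
proof (induction K arbitrary: L a rule: finite_induct)
  case empty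
  then have "L \<noteq> {}" by auto
  then show ?case by (intro exI[of _ "\<lambda>_. 1"]) auto
next
  case (insert k K)
  show ?case
  proof (cases "\<forall>l\<in>L. a k l = 0")
    case True
    have "card K < card L" using insert by simp
    then obtain c where "\<exists>l\<in>L. c l \<noteq> 0" "\<forall>k\<in>K. (\<Sum>l\<in>L. c l * a k l) = 0"
      using insert.IH[OF insert.prems(1), of a] by blast
    then show ?thesis using True by (intro exI[of _ c]) auto
  next
    case False
    then obtain l0 where l0: "l0 \<in> L" "a k l0 \<noteq> 0" by blast
    \<comment> \<open>Gaussian elimination: equation \<open>k\<close> determines the unknown at
      \<open>l0\<close>, and those in \<open>M\<close> remain subject to one equation for each
      member of \<open>K\<close>.\<close>
    define M where "M = L - {l0}"
    have M: "finite M" "card K < card M" "L = insert l0 M" "l0 \<notin> M"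
      using insert.prems insert.hyps l0 by (auto simp: M_def)
    obtain c where c: "\<exists>l\<in>M. c l \<noteq> 0"
        "\<forall>k'\<in>K. (\<Sum>l\<in>M. c l * (a k' l - a k' l0 * a k l / a k l0)) = 0"
      using insert.IH[OF M(1,2), of "\<lambda>k' l. a k' l - a k' l0 * a k l / a k l0"] by blast
    define s where "s = (\<Sum>l\<in>M. c l * a k l)"
    define d where "d = c(l0 := - s / a k l0)"
    have d: "(\<Sum>l\<in>L. d l * a k' l) = (\<Sum>l\<in>M. c l * a k' l) - s / a k l0 * a k' l0" for k'
    proof -
      have "(\<Sum>l\<in>M. d l * a k' l) = (\<Sum>l\<in>M. c l * a k' l)"
        using M by (intro sum.cong) (auto simp: d_def)
      then show ?thesis using M by (simp add: d_def)
    qed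
    have "(\<Sum>l\<in>L. d l * a k' l) = 0" if k': "k' \<in> insert k K" for k'
    proof (cases "k' = k")
      case True
      then show ?thesis using l0 by (simp add: d s_def)
    next
      case False
      then have "0 = (\<Sum>l\<in>M. c l * (a k' l - a k' l0 * a k l / a k l0))" using c k' by auto
      also have "\<dots> = (\<Sum>l\<in>M. c l * a k' l) - (\<Sum>l\<in>M. (c l * a k l) * (a k' l0 / a k l0))"
        by (simp add: right_diff_distrib sum_subtractf ac_simps)
      also have "(\<Sum>l\<in>M. (c l * a k l) * (a k' l0 / a k l0)) = s / a k l0 * a k' l0"
        by (simp add: s_def sum_distrib_right sum_divide_distrib)
      finally show ?thesis by (simp add: d)
    qed
    moreover have "\<exists>l\<in>L. d l \<noteq> 0" using c(1) M by (auto simp: d_def)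
    ultimately show ?thesis by blast
  qed
qed

text \<open>If more than \<open>card K\<close> weights are positive, their columns are dependent.
  Moving the weights along the dependency preserves all sums and can go on until a positive weight
  reaches 0. The weights need not sum to 1, so the bound is \<open>card K\<close> and not one
  more.\<close>

lemma caratheodory_cone:
  fixes a :: "'k \<Rightarrow> 'l \<Rightarrow> real"
  assumes K: "finite K" and L: "finite L" and p: "\<And>l. l \<in> L \<Longrightarrow> 0 \<le> p l"
  shows "\<exists>q. (\<forall>l\<in>L. 0 \<le> q l) \<and> card {l\<in>L. q l > 0} \<le> card K \<and>
    (\<forall>k\<in>K. (\<Sum>l\<in>L. q l * a k l) = (\<Sum>l\<in>L. p l * a k l))"
  using p
proof (induction "card {l\<in>L. p l > 0}" arbitrary: p rule: less_induct)
  case less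
  define S where "S = {l\<in>L. p l > 0}"
  have S: "finite S" "S \<subseteq> L" using L by (auto simp: S_def)
  show ?case
  proof (cases "card S \<le> card K")
    case True
    then show ?thesis using less.prems unfolding S_def by (intro exI[of _ p]) simp
  next
    case False
    then obtain c0 where c0: "\<exists>l\<in>S. c0 l \<noteq> 0" "\<forall>k\<in>K. (\<Sum>l\<in>S. c0 l * a k l) = 0"
      using linear_dependence[OF K S(1), of a] by auto
    obtain c where c: "\<exists>l\<in>S. c l > 0" "\<forall>k\<in>K. (\<Sum>l\<in>S. c l * a k l) = 0"
    proof (cases "\<exists>l\<in>S. c0 l > 0")
      case True then show ?thesis using c0 that by blast
    next
      case False
      then have "\<exists>l\<in>S. - c0 l > 0" using c0(1) by force
      moreover have "\<forall>k\<in>K. (\<Sum>l\<in>S. - c0 l * a k l) = 0"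
        using c0(2) by (simp add: sum_negf)
      ultimately show ?thesis using that[of "\<lambda>l. - c0 l"] by blast
    qed
    define T where "T = {l\<in>S. c l > 0}"
    have "finite T" "T \<noteq> {}" using S c(1) by (auto simp: T_def)
    then obtain l0 where l0: "l0 \<in> T" "\<And>l. l \<in> T \<Longrightarrow> p l0 / c l0 \<le> p l / c l"
      using arg_min_if_finite[of T "\<lambda>l. p l / c l"] by (meson not_less)
    \<comment> \<open>The largest step that keeps every weight nonnegative; the weight at
      \<open>l0\<close> becomes 0.\<close>
    define t where "t = p l0 / c l0"
    have t: "t > 0" using l0(1) by (auto simp: t_def T_def S_def)
    define q where "q l = (if l \<in> S then p l - t * c l else 0)" for l
    have q: "0 \<le> q l" for l
    proof (cases "l \<in> S")
      case True
      show ?thesis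
      proof (cases "c l > 0")
        case True
        then have "t \<le> p l / c l" using l0(2)[of l] \<open>l \<in> S\<close> by (simp add: t_def T_def)
        then show ?thesis using True by (simp add: q_def field_simps)
      next
        case False
        then have "t * c l \<le> 0" using t by (simp add: mult_nonneg_nonpos)
        moreover have "p l > 0" using \<open>l \<in> S\<close> by (simp add: S_def)
        ultimately show ?thesis by (simp add: q_def)
      qed
    qed (simp add: q_def)
    have "{l\<in>L. q l > 0} \<subset> S"
    proof -
      have "q l0 = 0" "l0 \<in> S" using l0(1) by (auto simp: q_def t_def T_def)
      moreover have "{l\<in>L. q l > 0} \<subseteq> S" by (auto simp: q_def split: if_splits)
      moreover have "l0 \<notin> {l\<in>L. q l > 0}" using \<open>q l0 = 0\<close> by simp
      ultimately show ?thesis by blast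
    qed
    then have card: "card {l\<in>L. q l > 0} < card {l\<in>L. p l > 0}"
      using S psubset_card_mono unfolding S_def by blast
    have sums: "(\<Sum>l\<in>L. q l * a k l) = (\<Sum>l\<in>L. p l * a k l)" if "k \<in> K" for k
    proof -
      have "(\<Sum>l\<in>L. q l * a k l) = (\<Sum>l\<in>S. (p l - t * c l) * a k l)"
        using L S by (intro sum.mono_neutral_cong_right) (auto simp: q_def)
      also have "\<dots> = (\<Sum>l\<in>S. p l * a k l) - t * (\<Sum>l\<in>S. c l * a k l)"
        by (simp add: algebra_simps sum_subtractf sum_distrib_left)
      also have "(\<Sum>l\<in>S. c l * a k l) = 0" using c that by blast
      also have "(\<Sum>l\<in>S. p l * a k l) = (\<Sum>l\<in>L. p l * a k l)"
        using L S less.prems by (intro sum.mono_neutral_left) (force simp: S_def)+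
      finally show ?thesis by simp
    qed
    obtain q' where "\<forall>l\<in>L. 0 \<le> q' l" "card {l\<in>L. q' l > 0} \<le> card K"
        "\<forall>k\<in>K. (\<Sum>l\<in>L. q' l * a k l) = (\<Sum>l\<in>L. q l * a k l)"
      using less.hyps[OF card q] by blast
    then show ?thesis using sums by (intro exI[of _ q']) simp
  qed
qed

section \<open>Separation from the separable cone\<close>

definition grid :: "nat \<Rightarrow> nat \<Rightarrow> (nat \<times> nat) set" where
  "grid m n = {..<m} \<times> {..<n}"

definition prodv :: "(nat \<Rightarrow> complex) \<Rightarrow> (nat \<Rightarrow> complex) \<Rightarrow> nat \<times> nat \<Rightarrow> complex" where
  "prodv v w = (\<lambda>(a, b). v a * w b)"

text \<open>Unnormalised: the nonnegative weights are absorbed into the vectors and the trace is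
  free, which makes this a cone.\<close>

definition sep_cone :: "nat \<Rightarrow> nat \<Rightarrow> (nat \<times> nat \<Rightarrow> nat \<times> nat \<Rightarrow> complex) \<Rightarrow> bool" where
  "sep_cone m n X \<longleftrightarrow> (\<exists>(k::nat) v w. \<forall>i\<in>grid m n. \<forall>j\<in>grid m n.
     X i j = (\<Sum>l<k. prodv (v l) (w l) i * cnj (prodv (v l) (w l) j)))"

lemma finite_grid [simp]: "finite (grid m n)"
  by (simp add: grid_def)

lemma prodv_pair [simp]: "prodv v w (a, b) = v a * w b"
  by (simp add: prodv_def)

lemma sep_coneI:
  fixes k :: nat
  assumes "\<And>i j. i \<in> grid m n \<Longrightarrow> j \<in> grid m n \<Longrightarrow>
    X i j = (\<Sum>l<k. prodv (v l) (w l) i * cnj (prodv (v l) (w l) j))"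
  shows "sep_cone m n X"
  unfolding sep_cone_def
  by (rule exI[of _ k], rule exI[of _ v], rule exI[of _ w]) (simp add: assms)

lemma sum_lessThan_append:
  fixes f :: "nat \<Rightarrow> 'a::comm_monoid_add"
  shows "(\<Sum>l<k + k'. if l < k then f l else g (l - k)) = (\<Sum>l<k. f l) + (\<Sum>l<k'. g l)"
  by (induction k') (simp_all add: ac_simps)

lemma sep_cone_add:
  assumes "sep_cone m n X" "sep_cone m n Y"
  shows "sep_cone m n (\<lambda>i j. X i j + Y i j)"
proof -
  obtain k :: nat and v w where X: "\<forall>i\<in>grid m n. \<forall>j\<in>grid m n.
     X i j = (\<Sum>l<k. prodv (v l) (w l) i * cnj (prodv (v l) (w l) j))"
    using assms(1) unfolding sep_cone_def by blast
  obtain k' :: nat and v' w' where Y: "\<forall>i\<in>grid m n. \<forall>j\<in>grid m n.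
     Y i j = (\<Sum>l<k'. prodv (v' l) (w' l) i * cnj (prodv (v' l) (w' l) j))"
    using assms(2) unfolding sep_cone_def by blast
  define v'' where "v'' l = (if l < k then v l else v' (l - k))" for l
  define w'' where "w'' l = (if l < k then w l else w' (l - k))" for l
  have "X i j + Y i j = (\<Sum>l<k + k'. prodv (v'' l) (w'' l) i * cnj (prodv (v'' l) (w'' l) j))"
    if "i \<in> grid m n" "j \<in> grid m n" for i j
  proof -
    have "(\<Sum>l<k + k'. prodv (v'' l) (w'' l) i * cnj (prodv (v'' l) (w'' l) j))
      = (\<Sum>l<k + k'. if l < k then prodv (v l) (w l) i * cnj (prodv (v l) (w l) j)
           else (\<lambda>l. prodv (v' l) (w' l) i * cnj (prodv (v' l) (w' l) j)) (l - k))"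
      by (intro sum.cong) (auto simp: v''_def w''_def)
    also have "\<dots> = (\<Sum>l<k. prodv (v l) (w l) i * cnj (prodv (v l) (w l) j))
        + (\<Sum>l<k'. prodv (v' l) (w' l) i * cnj (prodv (v' l) (w' l) j))"
      by (rule sum_lessThan_append)
    finally show ?thesis using X Y that by simp
  qed
  then show ?thesis by (rule sep_coneI)
qed

lemma sep_cone_scale:
  assumes "sep_cone m n X" "0 \<le> t"
  shows "sep_cone m n (\<lambda>i j. of_real t * X i j)"
proof -
  obtain k :: nat and v w where X: "\<forall>i\<in>grid m n. \<forall>j\<in>grid m n.
     X i j = (\<Sum>l<k. prodv (v l) (w l) i * cnj (prodv (v l) (w l) j))"
    using assms(1) unfolding sep_cone_def by blast
  have t: "complex_of_real t = of_real (sqrt t) * of_real (sqrt t)"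
    using assms(2) by (metis of_real_mult real_sqrt_mult_self abs_of_nonneg)
  have p: "prodv (\<lambda>a. of_real (sqrt t) * v l a) (w l) i = of_real (sqrt t) * prodv (v l) (w l) i" for l i
    by (cases i) simp
  have "of_real t * X i j = (\<Sum>l<k. prodv (\<lambda>a. of_real (sqrt t) * v l a) (w l) i
      * cnj (prodv (\<lambda>a. of_real (sqrt t) * v l a) (w l) j))"
    if "i \<in> grid m n" "j \<in> grid m n" for i j
    using X that unfolding p t by (simp add: sum_distrib_left algebra_simps)
  then show ?thesis by (rule sep_coneI)
qed

lemma sep_cone_prodv: "sep_cone m n (\<lambda>i j. prodv a b i * cnj (prodv a b j))"
  by (rule sep_coneI[where k = 1 and v = "\<lambda>_. a" and w = "\<lambda>_. b"]) simp

lemma sep_cone_cong: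
  assumes "\<And>i j. i \<in> grid m n \<Longrightarrow> j \<in> grid m n \<Longrightarrow> X i j = Y i j"
  shows "sep_cone m n X \<longleftrightarrow> sep_cone m n Y"
  unfolding sep_cone_def by (simp add: assms cong: ball_cong)

text \<open>Caratheodory bounds the number of terms and the trace bounds the vectors: together they
  make the part of the separable cone with bounded trace a continuous image of a compact set.\<close>
lemma sep_cone_bounded_representation:
  assumes X: "sep_cone m n X" and B: "(\<Sum>i\<in>grid m n. Re (X i i)) \<le> B\<^sup>2" and B0: "0 \<le> B"
  shows "\<exists>v w. (\<forall>l a. v l a \<in> cball 0 B) \<and> (\<forall>l b. w l b \<in> cball 0 1) \<and>
    (\<forall>i\<in>grid m n. \<forall>j\<in>grid m n. X i j =
      (\<Sum>l<card (grid m n \<times> grid m n \<times> (UNIV::bool set)). prodv (v l) (w l) i * cnj (prodv (v l) (w l) j)))"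
proof -
  let ?K = "grid m n \<times> grid m n \<times> (UNIV::bool set)"
  obtain k :: nat and v w where v: "\<forall>i\<in>grid m n. \<forall>j\<in>grid m n.
     X i j = (\<Sum>l<k. prodv (v l) (w l) i * cnj (prodv (v l) (w l) j))"
    using X unfolding sep_cone_def by blast
  define P where "P l i j = prodv (v l) (w l) i * cnj (prodv (v l) (w l) j)" for l i j
  \<comment> \<open>Real and imaginary parts of the entries are separate real equations, selected by
    the Boolean.\<close>
  define f where "f \<kappa> l = (case \<kappa> of (i, j, b) \<Rightarrow> if b then Re (P l i j) else Im (P l i j))" for \<kappa> l
  obtain q where q: "\<forall>l\<in>{..<k}. 0 \<le> q l" "card {l\<in>{..<k}. q l > 0} \<le> card ?K"
      "\<forall>\<kappa>\<in>?K. (\<Sum>l<k. q l * f \<kappa> l) = (\<Sum>l<k. 1 * f \<kappa> l)"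
    using caratheodory_cone[of ?K "{..<k}" "\<lambda>_. 1" f] by auto
  define S where "S = {l\<in>{..<k}. q l > 0}"
  have S: "finite S" "S \<subseteq> {..<k}" "card S \<le> card ?K" using q(2) by (auto simp: S_def)
  have XS: "X i j = (\<Sum>l\<in>S. of_real (q l) * P l i j)" if ij: "i \<in> grid m n" "j \<in> grid m n" for i j
  proof -
    have "(\<Sum>l<k. q l * Re (P l i j)) = (\<Sum>l<k. Re (P l i j))"
      using bspec[OF q(3), of "(i, j, True)"] ij by (simp add: f_def)
    moreover have "(\<Sum>l<k. q l * Im (P l i j)) = (\<Sum>l<k. Im (P l i j))"
      using bspec[OF q(3), of "(i, j, False)"] ij by (simp add: f_def)
    ultimately have "X i j = (\<Sum>l<k. of_real (q l) * P l i j)"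
      using v ij by (simp add: complex_eq_iff P_def[symmetric])
    also have "\<dots> = (\<Sum>l\<in>S. of_real (q l) * P l i j)"
      using q(1) by (intro sum.mono_neutral_right) (force simp: S_def)+
    finally show ?thesis .
  qed
  obtain e where e: "bij_betw e {..<card S} S"
    using ex_bij_betw_nat_finite[OF S(1)] by (auto simp: atLeast0LessThan)
  define N where "N s = sqrt (\<Sum>b<n. (cmod (w s b))\<^sup>2)" for s
  have N: "N s \<ge> 0" "(N s)\<^sup>2 = (\<Sum>b<n. (cmod (w s b))\<^sup>2)" for s
    by (simp_all add: N_def sum_nonneg)
  \<comment> \<open>The first factor carries all the weight and the second is normalised, so a bound
    on the trace bounds both. Terms from \<open>card S\<close> on are 0, which pads the sum to a
    length independent of \<open>X\<close>. If \<open>N (e l) = 0\<close>, both factors vanish, the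
    second by division by zero.\<close>
  define v' where "v' l a = (if l < card S \<and> a < m then of_real (sqrt (q (e l)) * N (e l)) * v (e l) a else 0)" for l a
  define w' where "w' l b = (if l < card S \<and> b < n then w (e l) b / of_real (N (e l)) else 0)" for l b
  have eS: "e l \<in> S" if "l < card S" for l
    using e that by (auto simp: bij_betw_def)
  have wN: "cmod (w s b) \<le> N s" if "b < n" for s b
    unfolding N_def using that by (intro real_le_rsqrt member_le_sum) auto
  have w1: "w' l b \<in> cball 0 1" for l b
    using wN[of b "e l"] N(1)[of "e l"] by (auto simp: w'_def norm_divide divide_le_eq_1)
  have prod: "prodv (v' l) (w' l) i = of_real (sqrt (q (e l))) * prodv (v (e l)) (w (e l)) i"
    if l: "l < card S" and i: "i \<in> grid m n" for l i
  proof -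
    obtain a b where i: "i = (a, b)" "a < m" "b < n" using i by (auto simp: grid_def)
    show ?thesis
    proof (cases "N (e l) = 0")
      case True
      then have "w (e l) b = 0" using wN[OF i(3), of "e l"] by simp
      then show ?thesis using i l by (simp add: v'_def w'_def)
    next
      case False
      then show ?thesis using i l by (simp add: v'_def w'_def)
    qed
  qed
  have "v' l a \<in> cball 0 B" for l a
  proof (cases "l < card S \<and> a < m")
    case True
    then have qs: "q (e l) \<ge> 0" "e l \<in> S" using eS[of l] by (auto simp: S_def)
    have "(cmod (v' l a))\<^sup>2 = q (e l) * (N (e l))\<^sup>2 * (cmod (v (e l) a))\<^sup>2"
      using True qs N(1)[of "e l"] by (simp add: v'_def norm_mult power_mult_distrib)
    also have "\<dots> = (\<Sum>b<n. q (e l) * (cmod (v (e l) a * w (e l) b))\<^sup>2)"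
      by (simp add: N(2) norm_mult power_mult_distrib sum_distrib_left sum_distrib_right ac_simps)
    also have "\<dots> \<le> (\<Sum>a<m. \<Sum>b<n. q (e l) * (cmod (v (e l) a * w (e l) b))\<^sup>2)"
      using True qs by (intro member_le_sum[of a "{..<m}" "\<lambda>a. \<Sum>b<n. q (e l) * (cmod (v (e l) a * w (e l) b))\<^sup>2"])
        (auto intro!: sum_nonneg)
    also have "\<dots> = (\<Sum>i\<in>grid m n. q (e l) * (cmod (prodv (v (e l)) (w (e l)) i))\<^sup>2)"
      by (simp add: grid_def sum.cartesian_product prodv_def case_prod_unfold)
    also have "\<dots> \<le> (\<Sum>s\<in>S. \<Sum>i\<in>grid m n. q s * (cmod (prodv (v s) (w s) i))\<^sup>2)"
      using qs S(1) by (intro member_le_sum[of "e l" S "\<lambda>s. \<Sum>i\<in>grid m n. q s * (cmod (prodv (v s) (w s) i))\<^sup>2"])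
        (auto intro!: sum_nonneg simp: S_def)
    also have "\<dots> = (\<Sum>i\<in>grid m n. \<Sum>s\<in>S. q s * (cmod (prodv (v s) (w s) i))\<^sup>2)"
      by (rule sum.swap)
    also have "\<dots> = (\<Sum>i\<in>grid m n. Re (X i i))"
      by (intro sum.cong refl) (simp add: XS P_def complex_norm_square[symmetric] del: of_real_power)
    also have "\<dots> \<le> B\<^sup>2" by (rule B)
    finally show ?thesis using B0 by (simp add: power2_le_iff_abs_le)
  qed (use B0 in \<open>auto simp: v'_def\<close>)
  moreover have "X i j = (\<Sum>l<card ?K. prodv (v' l) (w' l) i * cnj (prodv (v' l) (w' l) j))"
    if ij: "i \<in> grid m n" "j \<in> grid m n" for i j
  proof -
    have z: "prodv (v' l) (w' l) i = 0" if "\<not> l < card S" for l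
      using that by (cases i) (simp add: v'_def)
    have "(\<Sum>l<card ?K. prodv (v' l) (w' l) i * cnj (prodv (v' l) (w' l) j))
      = (\<Sum>l<card S. prodv (v' l) (w' l) i * cnj (prodv (v' l) (w' l) j))"
      using S(3) z by (intro sum.mono_neutral_right) auto
    also have "\<dots> = (\<Sum>l<card S. of_real (q (e l)) * P (e l) i j)"
    proof (intro sum.cong refl)
      fix l assume "l \<in> {..<card S}"
      then have l: "l < card S" by simp
      then have "complex_of_real (sqrt (q (e l))) * of_real (sqrt (q (e l))) = of_real (q (e l))"
        using eS[OF l] by (simp add: S_def flip: of_real_mult)
      note sq = this[symmetric]
      show "prodv (v' l) (w' l) i * cnj (prodv (v' l) (w' l) j) = of_real (q (e l)) * P (e l) i j"
        unfolding prod[OF l ij(1)] prod[OF l ij(2)] P_def sq by (simp add: mult.assoc mult.left_commute)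
    qed
    also have "\<dots> = (\<Sum>s\<in>S. of_real (q s) * P s i j)"
      by (rule sum.reindex_bij_betw[OF e])
    finally show ?thesis using XS[OF ij] by simp
  qed
  ultimately show ?thesis using w1 by blast
qed

lemma Re_diff_mult_cnj: "Re ((y - x) * cnj x) = Re ((y - x) * cnj y) - (cmod (y - x))\<^sup>2"
  unfolding cmod_power2 by (simp add: algebra_simps power2_eq_square)

lemma cmod_add_of_real_mult_power2:
  "(cmod (u + of_real t * z))\<^sup>2 = (cmod u)\<^sup>2 + (2 * t * Re (u * cnj z) + t\<^sup>2 * (cmod z)\<^sup>2)"
  unfolding cmod_power2 by (simp add: algebra_simps power2_eq_square)

lemma quadratic_nonneg_imp_linear_nonneg:
  fixes b c :: real
  assumes "\<And>t. 0 \<le> t \<Longrightarrow> t \<le> 1 \<Longrightarrow> 0 \<le> 2 * t * b + t\<^sup>2 * c"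
  shows "0 \<le> b"
proof (rule ccontr)
  assume b: "\<not> 0 \<le> b"
  define t where "t = min 1 (- b / (\<bar>c\<bar> + 1))"
  have "0 < - b / (\<bar>c\<bar> + 1)" using b by (intro divide_pos_pos) auto
  then have t: "0 < t" "t \<le> 1" by (auto simp: t_def)
  have "t \<le> - b / (\<bar>c\<bar> + 1)" by (simp add: t_def)
  then have "t * (\<bar>c\<bar> + 1) \<le> - b" by (subst (asm) pos_le_divide_eq) auto
  moreover have "t * c \<le> t * (\<bar>c\<bar> + 1)" using t by (intro mult_left_mono) auto
  ultimately have "2 * b + t * c < 0" using b by linarith
  then have "t * (2 * b + t * c) < 0" using t by (simp add: mult_pos_neg)
  then show False using assms[of t] t by (simp add: algebra_simps power2_eq_square)
qed

text \<open>The witness is the difference between the point of the separable cone nearest to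
  \<open>X\<close> and \<open>X\<close> itself.\<close>
lemma separating_witness:
  assumes H: "herm_on (grid m n) X" and ns: "\<not> sep_cone m n X"
  shows "\<exists>W. herm_on (grid m n) W \<and>
    (\<forall>a b. 0 \<le> Re (sform (grid m n) W (prodv a b) (prodv a b))) \<and>
    Re (tr_prod (grid m n) W X) < 0"
proof -
  let ?G = "grid m n"
  define d where "d = card (grid m n \<times> grid m n \<times> (UNIV::bool set))"
  define F where "F Y = (\<Sum>i\<in>?G. \<Sum>j\<in>?G. (cmod (Y i j - X i j))\<^sup>2)" for Y
  define M where "M = F (\<lambda>_ _. 0)"
  \<comment> \<open>A point of the cone no farther from \<open>X\<close> than the origin has
    diagonal entries within \<open>sqrt M\<close> of those of \<open>X\<close>, hence trace at most
    \<open>B\<^sup>2\<close>. Therefore the minimum over the compact set \<open>C\<close> is the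
    minimum over the whole cone.\<close>
  define B where "B = sqrt (\<Sum>i\<in>?G. cmod (X i i) + sqrt M)"
  have M0: "0 \<le> M" by (simp add: M_def F_def sum_nonneg)
  have B0: "0 \<le> B" and B2: "B\<^sup>2 = (\<Sum>i\<in>?G. cmod (X i i) + sqrt M)"
    using M0 by (simp_all add: B_def sum_nonneg)
  define Y where "Y p i j = (\<Sum>l<d. prodv (fst p l) (snd p l) i * cnj (prodv (fst p l) (snd p l) j))"
    for p :: "(nat \<Rightarrow> nat \<Rightarrow> complex) \<times> (nat \<Rightarrow> nat \<Rightarrow> complex)" and i j
  define C where "C = {v :: nat \<Rightarrow> nat \<Rightarrow> complex. \<forall>l. v l \<in> {f. \<forall>a. f a \<in> cball 0 B}}
      \<times> {w :: nat \<Rightarrow> nat \<Rightarrow> complex. \<forall>l. w l \<in> {f. \<forall>b. f b \<in> cball 0 1}}"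
  have compC: "compact C"
    unfolding C_def by (intro compact_Times compact_functions_into compact_cball)
  have c1: "continuous_on C (\<lambda>p. fst p l a)" for l a
    using continuous_on_product_then_coordinatewise[OF
        continuous_on_product_then_coordinatewise[OF continuous_on_fst[OF continuous_on_id]]] .
  have c2: "continuous_on C (\<lambda>p. snd p l a)" for l a
    using continuous_on_product_then_coordinatewise[OF
        continuous_on_product_then_coordinatewise[OF continuous_on_snd[OF continuous_on_id]]] .
  have contF: "continuous_on C (\<lambda>p. F (Y p))"
    unfolding F_def Y_def prodv_def case_prod_unfold by (intro continuous_intros c1 c2)
  have "(\<lambda>_ _. 0, \<lambda>_ _. 0) \<in> C" using B0 by (simp add: C_def)
  then obtain p where p: "p \<in> C" "\<And>p'. p' \<in> C \<Longrightarrow> F (Y p) \<le> F (Y p')"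
    using continuous_attains_inf[OF compC _ contF] by blast
  have YS: "sep_cone m n (Y p)"
    by (rule sep_coneI[where k = d and v = "fst p" and w = "snd p"]) (simp add: Y_def)
  have min: "F (Y p) \<le> F Z" if Z: "sep_cone m n Z" for Z
  proof (cases "F Z \<le> M")
    case True
    have "Re (Z i i) \<le> cmod (X i i) + sqrt M" if i: "i \<in> ?G" for i
    proof -
      have "(cmod (Z i i - X i i))\<^sup>2 \<le> (\<Sum>j\<in>?G. (cmod (Z i j - X i j))\<^sup>2)"
        using i by (intro member_le_sum[of i ?G "\<lambda>j. (cmod (Z i j - X i j))\<^sup>2"]) auto
      also have "\<dots> \<le> F Z" unfolding F_def
        using i by (intro member_le_sum[of i ?G "\<lambda>i. \<Sum>j\<in>?G. (cmod (Z i j - X i j))\<^sup>2"]) (auto intro!: sum_nonneg)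
      finally have "cmod (Z i i - X i i) \<le> sqrt M"
        using True by (intro real_le_rsqrt) simp
      moreover have "Re (Z i i) \<le> cmod (Z i i)" by (rule complex_Re_le_cmod)
      moreover have "cmod (Z i i) \<le> cmod (X i i) + cmod (Z i i - X i i)"
        using norm_triangle_sub[of "Z i i" "X i i"] by simp
      ultimately show ?thesis by linarith
    qed
    then have "(\<Sum>i\<in>?G. Re (Z i i)) \<le> B\<^sup>2" unfolding B2 by (intro sum_mono)
    from sep_cone_bounded_representation[OF Z this B0] obtain v w where
      vw: "\<forall>l a. v l a \<in> cball 0 B" "\<forall>l b. w l b \<in> cball 0 1"
        "\<forall>i\<in>?G. \<forall>j\<in>?G. Z i j = (\<Sum>l<d. prodv (v l) (w l) i * cnj (prodv (v l) (w l) j))"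
      unfolding d_def by blast
    then have "(v, w) \<in> C" "F Z = F (Y (v, w))"
      unfolding C_def F_def Y_def by (blast, intro sum.cong refl) auto
    then show ?thesis using p(2) by simp
  next
    case False
    have "Y (\<lambda>_ _. 0, \<lambda>_ _. 0) = (\<lambda>_ _. 0)"
      by (auto simp: Y_def fun_eq_iff)
    then have "F (Y p) \<le> M"
      using p(2)[OF \<open>(\<lambda>_ _. 0, \<lambda>_ _. 0) \<in> C\<close>] by (simp add: M_def)
    then show ?thesis using False by simp
  qed
  define W where "W i j = Y p i j - X i j" for i j
  \<comment> \<open>Half the derivative of \<open>F\<close> at \<open>Y p\<close> in the direction
    \<open>Z\<close>; it is nonnegative if the segment stays in the cone.\<close>
  define ip where "ip Z = (\<Sum>i\<in>?G. \<Sum>j\<in>?G. Re (W i j * cnj (Z i j)))" for Z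
  have F_line: "F (\<lambda>i j. Y p i j + of_real t * Z i j)
      = F (Y p) + (2 * t * ip Z + t\<^sup>2 * (\<Sum>i\<in>?G. \<Sum>j\<in>?G. (cmod (Z i j))\<^sup>2))" for t Z
  proof -
    define R where "R i j = Re (W i j * cnj (Z i j))" for i j
    have "(cmod (Y p i j + of_real t * Z i j - X i j))\<^sup>2
      = (cmod (Y p i j - X i j))\<^sup>2 + (2 * t * R i j + t\<^sup>2 * (cmod (Z i j))\<^sup>2)" for i j
      using cmod_add_of_real_mult_power2[of "Y p i j - X i j" t "Z i j"] by (simp add: R_def W_def diff_add_eq)
    moreover have "ip Z = (\<Sum>i\<in>?G. \<Sum>j\<in>?G. R i j)"
      unfolding ip_def R_def ..
    ultimately show ?thesis
      by (simp add: F_def sum.distrib sum_distrib_left)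
  qed
  have ip_nonneg: "0 \<le> ip Z"
    if "\<And>t. 0 \<le> t \<Longrightarrow> t \<le> 1 \<Longrightarrow> sep_cone m n (\<lambda>i j. Y p i j + of_real t * Z i j)" for Z
    by (rule quadratic_nonneg_imp_linear_nonneg[where c = "\<Sum>i\<in>?G. \<Sum>j\<in>?G. (cmod (Z i j))\<^sup>2"])
      (use min[OF that] in \<open>simp add: F_line\<close>)
  have YH: "herm_on ?G (Y p)"
    by (simp add: herm_on_def Y_def mult.commute)
  have "herm_on ?G W"
    using YH H unfolding herm_on_def W_def by (metis complex_cnj_diff)
  moreover have "0 \<le> Re (sform ?G W (prodv a b) (prodv a b))" for a b
  proof -
    have "0 \<le> ip (\<lambda>i j. prodv a b i * cnj (prodv a b j))"
      by (intro ip_nonneg sep_cone_add YS sep_cone_scale sep_cone_prodv)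
    also have "\<dots> = Re (sform ?G W (prodv a b) (prodv a b))"
      by (simp add: ip_def sform_def ac_simps)
    finally show ?thesis .
  qed
  moreover have "Re (tr_prod ?G W X) < 0"
  proof -
    \<comment> \<open>The direction towards the apex: the segment consists of the multiples (1 - t)
      \<open>Y p\<close>.\<close>
    have "0 \<le> ip (\<lambda>i j. - Y p i j)"
    proof (rule ip_nonneg)
      fix t :: real assume "0 \<le> t" "t \<le> 1"
      then have "sep_cone m n (\<lambda>i j. of_real (1 - t) * Y p i j)"
        by (intro sep_cone_scale YS) simp
      moreover have "(\<lambda>i j. of_real (1 - t) * Y p i j) = (\<lambda>i j. Y p i j + of_real t * - Y p i j)"
        by (simp add: fun_eq_iff algebra_simps)
      ultimately show "sep_cone m n (\<lambda>i j. Y p i j + of_real t * - Y p i j)" by simp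
    qed
    moreover have "ip (\<lambda>i j. - Y p i j) = - ip (Y p)"
      unfolding ip_def by (simp only: complex_cnj_minus mult_minus_right uminus_complex.sel sum_negf)
    ultimately have 1: "ip (Y p) \<le> 0" by simp
    have "F (Y p) \<noteq> 0"
    proof
      assume "F (Y p) = 0"
      then have "\<forall>i\<in>?G. \<forall>j\<in>?G. Y p i j = X i j"
        unfolding F_def by (subst (asm) sum_nonneg_eq_0_iff; auto simp: sum_nonneg_eq_0_iff sum_nonneg)
      then show False using YS ns sep_cone_cong by metis
    qed
    then have 2: "F (Y p) > 0" by (simp add: F_def sum_nonneg order_less_le)
    \<comment> \<open>Since \<open>X\<close> is \<open>Y p\<close> minus \<open>W\<close>, the
      pairing is that of \<open>W\<close> with \<open>Y p\<close> minus the squared norm of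
      \<open>W\<close>.\<close>
    have "Re (tr_prod ?G W X) = (\<Sum>i\<in>?G. \<Sum>j\<in>?G. Re (W i j * cnj (X i j)))"
      unfolding tr_prod_def using herm_onD'[OF H] by (simp del: complex_cnj_cnj times_complex.sel)
    also have "\<dots> = (\<Sum>i\<in>?G. \<Sum>j\<in>?G. Re (W i j * cnj (Y p i j)) - (cmod (Y p i j - X i j))\<^sup>2)"
      using Re_diff_mult_cnj by (intro sum.cong refl) (simp add: W_def)
    also have "\<dots> = ip (Y p) - F (Y p)" by (simp add: ip_def F_def sum_subtractf)
    finally show ?thesis using 1 2 by simp
  qed
  ultimately show ?thesis by blast
qed

section \<open>Entangled states with positive partial transpose and prescribed kernel\<close>

definition pt :: "(nat \<times> nat \<Rightarrow> nat \<times> nat \<Rightarrow> complex) \<Rightarrow> nat \<times> nat \<Rightarrow> nat \<times> nat \<Rightarrow> complex" where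
  "pt A i j = A (fst j, snd i) (fst i, snd j)"

text \<open>As \<open>pt Y\<close> is positive, the vanishing form puts \<psi> into its kernel.
  Dually, the partial transpose of |\<psi>><\<psi>| pairs to 0 with \<open>Y\<close>. The trace of
  \<open>Y\<close> is left free.\<close>

definition null_edge_state :: "nat \<Rightarrow> nat \<Rightarrow> (nat \<times> nat \<Rightarrow> complex) \<Rightarrow> bool" where
  "null_edge_state m n \<psi> \<longleftrightarrow> (\<exists>Y. psd_on (grid m n) Y \<and> psd_on (grid m n) (pt Y) \<and>
     sform (grid m n) (pt Y) \<psi> \<psi> = 0 \<and> \<not> sep_cone m n Y)"

definition single_entry :: "real \<Rightarrow> nat \<Rightarrow> nat \<Rightarrow> nat \<Rightarrow> nat \<Rightarrow> real" where
  "single_entry c a b i j = (if i = a \<and> j = b then c else 0)"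

lemma sum_grid: "(\<Sum>i\<in>grid m n. F i) = (\<Sum>a<m. \<Sum>b<n. F (a, b))"
  by (simp add: grid_def sum.cartesian_product case_prod_unfold)

lemma sum_single_entry:
  assumes "a < m" "b < n"
  shows "(\<Sum>i<m. \<Sum>j<n. complex_of_real (single_entry c a b i j) * M i j) = of_real c * M a b"
proof -
  have "(\<Sum>j<n. complex_of_real (single_entry c a b i j) * M i j) = (if i = a then of_real c * M a b else 0)" for i
  proof (cases "i = a")
    case True
    have "(\<Sum>j<n. complex_of_real (single_entry c a b a j) * M a j) = (\<Sum>j<n. if j = b then of_real c * M a b else 0)"
      by (intro sum.cong) (auto simp: single_entry_def)
    then show ?thesis using True assms by simp
  qed (simp add: single_entry_def)
  then show ?thesis using assms by simp
qed

section \<open>Gram forms in a frame and the range criterion\<close>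

lemma frame_vector_gram:
  fixes As :: "(nat \<Rightarrow> nat \<Rightarrow> real) list" and f :: "nat \<Rightarrow> nat \<Rightarrow> complex" and n :: nat
  defines "F \<equiv> \<lambda>A a b. \<Sum>j<n. of_real (A a j) * f j b"
  shows "(\<Sum>l<length As. F (As ! l) a b * cnj (F (As ! l) a' b'))
    = (\<Sum>j<n. \<Sum>j'<n. of_real (\<Sum>A\<leftarrow>As. A a j * A a' j') * (f j b * cnj (f j' b')))"
proof -
  have "(\<Sum>l<length As. F (As ! l) a b * cnj (F (As ! l) a' b'))
    = (\<Sum>l<length As. \<Sum>j<n. \<Sum>j'<n. of_real ((As ! l) a j * (As ! l) a' j') * (f j b * cnj (f j' b')))"
    unfolding F_def cnj_sum sum_product by (simp add: ac_simps)
  also have "\<dots> = (\<Sum>j<n. \<Sum>l<length As. \<Sum>j'<n. of_real ((As ! l) a j * (As ! l) a' j') * (f j b * cnj (f j' b')))"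
    by (rule sum.swap)
  also have "\<dots> = (\<Sum>j<n. \<Sum>j'<n. \<Sum>l<length As. of_real ((As ! l) a j * (As ! l) a' j') * (f j b * cnj (f j' b')))"
    by (rule sum.cong[OF refl], rule sum.swap)
  also have "\<dots> = (\<Sum>j<n. \<Sum>j'<n. of_real (\<Sum>A\<leftarrow>As. A a j * A a' j') * (f j b * cnj (f j' b')))"
    by (simp add: sum_list_sum_nth atLeast0LessThan sum_distrib_right)
  finally show ?thesis .
qed

lemma frame_pairing:
  fixes K A :: "nat \<Rightarrow> nat \<Rightarrow> real"
  assumes dual: "\<And>j j'. j < n \<Longrightarrow> j' < n \<Longrightarrow> (\<Sum>b<n. g j b * f j' b) = (if j = j' then 1 else 0)"
  shows "(\<Sum>a<m. \<Sum>b<n. (\<Sum>j<n. of_real (K a j) * g j b) * (\<Sum>j<n. of_real (A a j) * f j b))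
    = (\<Sum>a<m. \<Sum>j<n. complex_of_real (K a j) * of_real (A a j))"
proof (rule sum.cong[OF refl])
  fix a
  have "(\<Sum>b<n. (\<Sum>j<n. complex_of_real (K a j) * g j b) * (\<Sum>j<n. of_real (A a j) * f j b))
    = (\<Sum>b<n. \<Sum>j<n. \<Sum>j'<n. of_real (K a j) * of_real (A a j') * (g j b * f j' b))"
    unfolding sum_product by (simp add: ac_simps)
  also have "\<dots> = (\<Sum>j<n. \<Sum>b<n. \<Sum>j'<n. of_real (K a j) * of_real (A a j') * (g j b * f j' b))"
    by (rule sum.swap)
  also have "\<dots> = (\<Sum>j<n. \<Sum>j'<n. \<Sum>b<n. of_real (K a j) * of_real (A a j') * (g j b * f j' b))"
    by (rule sum.cong[OF refl], rule sum.swap)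
  also have "\<dots> = (\<Sum>j<n. \<Sum>j'<n. of_real (K a j) * of_real (A a j') * (if j = j' then 1 else 0))"
    by (intro sum.cong refl) (simp add: sum_distrib_left[symmetric] dual)
  also have "\<dots> = (\<Sum>j<n. complex_of_real (K a j) * of_real (A a j))"
    by (intro sum.cong refl) (simp add: if_distrib[of "\<lambda>u. _ * u"] cong: if_cong)
  finally show "(\<Sum>b<n. (\<Sum>j<n. complex_of_real (K a j) * g j b) * (\<Sum>j<n. of_real (A a j) * f j b))
    = (\<Sum>j<n. complex_of_real (K a j) * of_real (A a j))" .
qed

lemma gram_isotropic:
  assumes "sform I (\<lambda>i j. \<Sum>l<k. v l i * cnj (v l j)) z z = 0" "l < (k::nat)"
  shows "(\<Sum>i\<in>I. cnj (z i) * v l i) = 0"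
proof -
  have "complex_of_real (\<Sum>l<k. (cmod (\<Sum>i\<in>I. cnj (z i) * v l i))\<^sup>2) = 0"
    by (rule trans[OF sform_gram[symmetric] assms(1)])
  then have "(\<Sum>l<k. (cmod (\<Sum>i\<in>I. cnj (z i) * v l i))\<^sup>2) = 0" by (simp only: of_real_eq_0_iff)
  then show ?thesis using assms(2) by (simp add: sum_nonneg_eq_0_iff)
qed

text \<open>A list of triples \<open>(c, i, j)\<close> stands for the linear functional \<open>A \<mapsto> \<Sum> c A\<^sub>i\<^sub>j\<close>.\<close>
definition annihilates :: "(nat \<Rightarrow> nat \<Rightarrow> real) list \<Rightarrow> (real \<times> nat \<times> nat) list \<Rightarrow> bool" where
  "annihilates As ts \<longleftrightarrow> (\<forall>A\<in>set As. (\<Sum>(c, i, j)\<leftarrow>ts. c * A i j) = 0)"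

text \<open>Equivalently, the \<open>m\<close> by \<open>n\<close> matrix with entries
  \<open>x i * y j\<close> lies in the complex span of the \<open>As\<close>, cut down to that size;
  real functionals detect this because the \<open>As\<close> are real.\<close>

definition orthogonal_to_kernel :: "nat \<Rightarrow> nat \<Rightarrow> (nat \<Rightarrow> nat \<Rightarrow> real) list \<Rightarrow> (nat \<Rightarrow> complex) \<Rightarrow> (nat \<Rightarrow> complex) \<Rightarrow> bool" where
  "orthogonal_to_kernel m n As x y \<longleftrightarrow> (\<forall>ts. (\<forall>(c, i, j)\<in>set ts. i < m \<and> j < n) \<longrightarrow> annihilates As ts \<longrightarrow>
     (\<Sum>(c, i, j)\<leftarrow>ts. of_real c * (x i * y j)) = 0)"

lemma sum_terms:
  assumes "\<forall>(c, i, j)\<in>set ts. i < m \<and> j < n"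
  shows "(\<Sum>a<m. \<Sum>b<n. complex_of_real (\<Sum>(c, i, j)\<leftarrow>ts. single_entry c i j a b) * M a b)
    = (\<Sum>(c, i, j)\<leftarrow>ts. of_real c * M i j)"
  using assms
proof (induction ts)
  case (Cons t ts)
  obtain c i j where t: "t = (c, i, j)" by (cases t)
  then show ?case using Cons sum_single_entry[of i m j n c M]
    by (simp add: distrib_right sum.distrib)
qed simp

text \<open>Range criterion: a product vector occurring in a decomposition of \<open>Y\<close> is orthogonal to the
  kernel of \<open>Y\<close>, and its conjugate in the first factor is orthogonal to the kernel of the partial
  transpose.  Here \<open>Y\<close> and its partial transpose are given by the lists of real coefficient matrices
  \<open>Us\<close> and \<open>Vs\<close> with respect to the standard basis of the first factor and the basis \<open>f\<close> of the
  second one; \<open>g\<close> is the basis dual to \<open>f\<close>.\<close>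
lemma null_edge_state_frame:
  fixes Us Vs :: "(nat \<Rightarrow> nat \<Rightarrow> real) list" and f g :: "nat \<Rightarrow> nat \<Rightarrow> complex"
  assumes transp: "\<And>i j i' j'. (\<Sum>A\<leftarrow>Us. A i' j * A i j') = (\<Sum>A\<leftarrow>Vs. A i j * A i' j')"
    and dual: "\<And>j j'. j < n \<Longrightarrow> j' < n \<Longrightarrow> (\<Sum>b<n. g j b * f j' b) = (if j = j' then 1 else 0)"
    and dual': "\<And>b b'. b < n \<Longrightarrow> b' < n \<Longrightarrow> (\<Sum>j<n. g j b * f j b') = (if b = b' then 1 else 0)"
    and r: "r \<le> m" "r \<le> n"
    and \<psi>: "\<And>a j. a < r \<Longrightarrow> j < n \<Longrightarrow> (\<Sum>b<n. cnj (\<psi> (a, b)) * f j b) = (if a = j then 1 else 0)"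
    and supp: "\<And>A a j. A \<in> set Vs \<Longrightarrow> r \<le> a \<Longrightarrow> A a j = 0"
    and traceless: "\<And>A. A \<in> set Vs \<Longrightarrow> (\<Sum>a<r. A a a) = 0"
    and nonzero: "A0 \<in> set Us" "i0 < m" "j0 < n" "A0 i0 j0 \<noteq> 0"
    and rigid: "\<And>x y i j. orthogonal_to_kernel m n Us x y \<Longrightarrow>
      orthogonal_to_kernel m n Vs (\<lambda>i. cnj (x i)) y \<Longrightarrow> i < m \<Longrightarrow> j < n \<Longrightarrow> x i * y j = 0"
  shows "null_edge_state m n \<psi>"
proof -
  let ?G = "grid m n"
  define F where "F A = (\<lambda>(a, b). \<Sum>j<n. complex_of_real (A a j) * f j b)" for A :: "nat \<Rightarrow> nat \<Rightarrow> real"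
  define Y where "Y = (\<lambda>i k. \<Sum>l<length Us. F (Us ! l) i * cnj (F (Us ! l) k))"
  define Z where "Z = (\<lambda>i k. \<Sum>l<length Vs. F (Vs ! l) i * cnj (F (Vs ! l) k))"
  \<comment> \<open>The frame affects only the second factor, which partial transposition leaves
    alone, and real coefficients are unchanged by conjugation; what remains is
    \<open>transp\<close>.\<close>
  have YZ: "pt Y = Z"
  proof (intro ext)
    fix i k :: "nat \<times> nat"
    obtain a b a' b' where ik: "i = (a, b)" "k = (a', b')" by (cases i, cases k)
    show "pt Y i k = Z i k"
      unfolding pt_def ik Y_def Z_def F_def fst_conv snd_conv prod.case frame_vector_gram transp ..
  qed
  have psd: "psd_on ?G Y" "psd_on ?G (pt Y)"
    unfolding YZ unfolding Y_def Z_def by (rule psd_on_gram)+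
  have "(\<Sum>i\<in>?G. cnj (\<psi> i) * F A i) = 0" if A: "A \<in> set Vs" for A
  proof -
    \<comment> \<open>Row \<open>a\<close> of \<psi> is dual to the frame, so only the diagonal
      entry survives and the whole pairing is the trace of \<open>A\<close>.\<close>
    have row: "(\<Sum>b<n. cnj (\<psi> (a, b)) * F A (a, b)) = (if a < r then of_real (A a a) else 0)" for a
    proof (cases "a < r")
      case True
      have "(\<Sum>b<n. cnj (\<psi> (a, b)) * F A (a, b)) = (\<Sum>b<n. \<Sum>j<n. of_real (A a j) * (cnj (\<psi> (a, b)) * f j b))"
        by (simp add: F_def sum_distrib_left ac_simps)
      also have "\<dots> = (\<Sum>j<n. \<Sum>b<n. of_real (A a j) * (cnj (\<psi> (a, b)) * f j b))"
        by (rule sum.swap)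
      also have "\<dots> = (\<Sum>j<n. of_real (A a j) * (if a = j then 1 else 0))"
        by (intro sum.cong refl) (simp add: sum_distrib_left[symmetric] \<psi> True)
      also have "\<dots> = of_real (A a a)"
        using True r by (simp add: if_distrib[of "\<lambda>u. _ * u"] cong: if_cong)
      finally show ?thesis using True by simp
    qed (simp add: F_def supp[OF A])
    have "(\<Sum>i\<in>?G. cnj (\<psi> i) * F A i) = (\<Sum>a<m. if a < r then of_real (A a a) else 0)"
      by (simp add: sum_grid row)
    also have "\<dots> = (\<Sum>a<r. of_real (A a a))"
      using r by (intro sum.mono_neutral_cong_right) auto
    also have "\<dots> = 0" using traceless[OF A] by (simp flip: of_real_sum)
    finally show ?thesis .
  qed
  then have null: "sform ?G (pt Y) \<psi> \<psi> = 0"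
    unfolding YZ Z_def sform_gram by simp
  \<comment> \<open>Vectors that act on coefficient matrices as the functional \<open>K\<close>; the
    outer conjugation undoes the one in the first argument of \<open>sform\<close>.\<close>
  define z where "z K = (\<lambda>(a, b). cnj (\<Sum>j<n. complex_of_real (K a j) * g j b))" for K :: "nat \<Rightarrow> nat \<Rightarrow> real"
  have zF: "(\<Sum>i\<in>?G. cnj (z K i) * F A i) = (\<Sum>a<m. \<Sum>j<n. of_real (K a j) * of_real (A a j))" for K A
    unfolding sum_grid z_def F_def by (simp add: frame_pairing[OF dual])
  define K where "K ts a b = (\<Sum>(c, i, j)\<leftarrow>ts. single_entry c i j a b)" for ts a b
  have ztF: "(\<Sum>i\<in>?G. cnj (z (K ts) i) * F A i) = of_real (\<Sum>(c, i, j)\<leftarrow>ts. c * A i j)"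
    if "\<forall>(c, i, j)\<in>set ts. i < m \<and> j < n" for ts A
  proof -
    have "(\<Sum>i\<in>?G. cnj (z (K ts) i) * F A i) = (\<Sum>(c, i, j)\<leftarrow>ts. of_real c * of_real (A i j))"
      unfolding zF K_def using sum_terms[OF that, of "\<lambda>i j. of_real (A i j)"] .
    also have "\<dots> = of_real (\<Sum>(c, i, j)\<leftarrow>ts. c * A i j)"
      by (induction ts) auto
    finally show ?thesis .
  qed
  have isoY: "sform ?G (\<lambda>i k. \<Sum>l<length As. F (As ! l) i * cnj (F (As ! l) k)) (z (K ts)) (z (K ts)) = 0"
    if "\<forall>(c, i, j)\<in>set ts. i < m \<and> j < n" "annihilates As ts" for As ts
    unfolding sform_gram using that by (simp add: ztF annihilates_def)
  have "\<not> sep_cone m n Y"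
  proof
    assume "sep_cone m n Y"
    then obtain k :: nat and v w where vw: "\<forall>i\<in>?G. \<forall>j\<in>?G.
       Y i j = (\<Sum>l<k. prodv (v l) (w l) i * cnj (prodv (v l) (w l) j))"
      unfolding sep_cone_def by blast
    \<comment> \<open>Partial transposition conjugates the first factor of a product ketbra.\<close>
    define x where "x l a = cnj (v l a)" for l a
    define y where "y l j = (\<Sum>b<n. g j b * w l b)" for l j
    have vw': "pt Y i j = (\<Sum>l<k. prodv (x l) (w l) i * cnj (prodv (x l) (w l) j))"
      if "i \<in> ?G" "j \<in> ?G" for i j
    proof -
      obtain a b a' b' where ij: "i = (a, b)" "j = (a', b')" by (cases i, cases j)
      have "(a', b) \<in> ?G" "(a, b') \<in> ?G" using that by (auto simp: grid_def ij)
      then show ?thesis using vw by (simp add: pt_def ij x_def ac_simps)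
    qed
    have zprod: "(\<Sum>i\<in>?G. cnj (z (K ts) i) * prodv u (w l) i) = (\<Sum>(c, i, j)\<leftarrow>ts. of_real c * (u i * y l j))"
      if "\<forall>(c, i, j)\<in>set ts. i < m \<and> j < n" for ts u l
    proof -
      have "(\<Sum>i\<in>?G. cnj (z (K ts) i) * prodv u (w l) i)
        = (\<Sum>a<m. \<Sum>b<n. \<Sum>j<n. of_real (K ts a j) * (u a * (g j b * w l b)))"
        by (simp add: sum_grid z_def sum_distrib_left sum_distrib_right ac_simps)
      also have "\<dots> = (\<Sum>a<m. \<Sum>j<n. \<Sum>b<n. of_real (K ts a j) * (u a * (g j b * w l b)))"
        by (rule sum.cong[OF refl], rule sum.swap)
      also have "\<dots> = (\<Sum>a<m. \<Sum>j<n. of_real (K ts a j) * (u a * y l j))"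
        by (simp add: y_def sum_distrib_left)
      also have "\<dots> = (\<Sum>(c, i, j)\<leftarrow>ts. of_real c * (u i * y l j))"
        unfolding K_def by (rule sum_terms[OF that])
      finally show ?thesis .
    qed
    have zero: "prodv (v l) (w l) i = 0" if l: "l < k" and i: "i \<in> ?G" for l i
    proof -
      have oU: "orthogonal_to_kernel m n Us (v l) (y l)"
        unfolding orthogonal_to_kernel_def
      proof (intro allI impI)
        fix ts assume ts: "\<forall>(c, i, j)\<in>set ts. i < m \<and> j < n" "annihilates Us ts"
        have "sform ?G (\<lambda>i j. \<Sum>l<k. prodv (v l) (w l) i * cnj (prodv (v l) (w l) j)) (z (K ts)) (z (K ts))
          = sform ?G Y (z (K ts)) (z (K ts))"
          by (rule sform_cong) (use vw in auto)
        also have "\<dots> = 0" unfolding Y_def by (rule isoY[OF ts])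
        finally have iso: "sform ?G (\<lambda>i j. \<Sum>l<k. prodv (v l) (w l) i * cnj (prodv (v l) (w l) j)) (z (K ts)) (z (K ts)) = 0" .
        show "(\<Sum>(c, i, j)\<leftarrow>ts. of_real c * (v l i * y l j)) = 0"
          using gram_isotropic[OF iso l] unfolding zprod[OF ts(1)] .
      qed
      have oV: "orthogonal_to_kernel m n Vs (\<lambda>i. cnj (v l i)) (y l)"
        unfolding orthogonal_to_kernel_def
      proof (intro allI impI)
        fix ts assume ts: "\<forall>(c, i, j)\<in>set ts. i < m \<and> j < n" "annihilates Vs ts"
        have "sform ?G (\<lambda>i j. \<Sum>l<k. prodv (x l) (w l) i * cnj (prodv (x l) (w l) j)) (z (K ts)) (z (K ts))
          = sform ?G Z (z (K ts)) (z (K ts))"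
          by (rule sform_cong) (use vw' YZ in auto)
        also have "\<dots> = 0" unfolding Z_def by (rule isoY[OF ts])
        finally have iso: "sform ?G (\<lambda>i j. \<Sum>l<k. prodv (x l) (w l) i * cnj (prodv (x l) (w l) j)) (z (K ts)) (z (K ts)) = 0" .
        have "(\<Sum>(c, i, j)\<leftarrow>ts. of_real c * (x l i * y l j)) = 0"
          using gram_isotropic[OF iso l] unfolding zprod[OF ts(1)] .
        then show "(\<Sum>(c, i, j)\<leftarrow>ts. of_real c * (cnj (v l i) * y l j)) = 0"
          by (simp add: x_def)
      qed
      obtain a b where ab: "i = (a, b)" "a < m" "b < n" using i by (auto simp: grid_def)
      have "(\<Sum>j<n. f j b * y l j) = (\<Sum>j<n. \<Sum>b'<n. w l b' * (g j b' * f j b))"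
        by (simp add: y_def sum_distrib_left ac_simps)
      also have "\<dots> = (\<Sum>b'<n. \<Sum>j<n. w l b' * (g j b' * f j b))"
        by (rule sum.swap)
      also have "\<dots> = (\<Sum>b'<n. w l b' * (if b' = b then 1 else 0))"
        by (intro sum.cong refl) (simp add: sum_distrib_left[symmetric] dual' ab)
      also have "\<dots> = w l b"
        using ab by (simp add: if_distrib[of "\<lambda>u. _ * u"] cong: if_cong)
      finally have "v l a * w l b = v l a * (\<Sum>j<n. f j b * y l j)" by simp
      also have "\<dots> = (\<Sum>j<n. v l a * (f j b * y l j))"
        by (simp only: sum_distrib_left)
      also have "\<dots> = (\<Sum>j<n. f j b * (v l a * y l j))"
        by (simp only: mult.left_commute)
      also have "\<dots> = 0"
        using rigid[OF oU oV ab(2)] by (auto intro!: sum.neutral)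
      finally show ?thesis by (simp add: ab)
    qed
    obtain l0 where l0: "l0 < length Us" "A0 = Us ! l0" using nonzero(1) by (metis in_set_conv_nth)
    \<comment> \<open>With all product terms zero, \<open>Y\<close> vanishes; the functional that
      reads entry \<open>(i0, j0)\<close> shows that it does not.\<close>
    let ?z = "z (K [(1, i0, j0)])"
    have "Y i j = 0" if "i \<in> ?G" "j \<in> ?G" for i j
      using vw that zero by simp
    then have "sform ?G Y ?z ?z = 0" by (simp add: sform_def)
    then have "(\<Sum>i\<in>?G. cnj (?z i) * F A0 i) = 0"
      unfolding Y_def l0(2) by (rule gram_isotropic) (rule l0(1))
    then show False using ztF[of "[(1, i0, j0)]" A0] nonzero by simp
  qed
  then show ?thesis unfolding null_edge_state_def using psd null by blast
qed

text \<open>Three terms cover every relation of the two examples; shorter relations are padded with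
  coefficient 0.\<close>

lemma orthogonal_to_kernelD:
  assumes "orthogonal_to_kernel m n As x y" "annihilates As [(c, i, j), (c', i', j'), (c'', i'', j'')]"
    and "i < m" "j < n" "i' < m" "j' < n" "i'' < m" "j'' < n"
  shows "of_real c * (x i * y j) + (of_real c' * (x i' * y j') + of_real c'' * (x i'' * y j'')) = 0"
  using assms(1) assms(2-) unfolding orthogonal_to_kernel_def
  by (elim allE[of _ "[(c, i, j), (c', i', j'), (c'', i'', j'')]"]) simp

lemma orthogonal_to_kernel_entry:
  assumes "orthogonal_to_kernel m n As x y" "i < m" "j < n" "\<And>A. A \<in> set As \<Longrightarrow> A i j = 0"
  shows "x i * y j = 0"
  using orthogonal_to_kernelD[OF assms(1), of 1 i j 0 i j 0 i j] assms by (simp add: annihilates_def)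

section \<open>The 3 x 3 and 2 x 4 examples\<close>

text \<open>Up to the factors \<open>1, 1, -2\<close> on the columns, which make the first matrix of \<open>V3\<close> traceless,
  \<open>V3\<close> describes the circulant state \<open>4|\<Phi>\<rangle>\<langle>\<Phi>| + \<Sum>\<^sub>i (16|i,i+1\<rangle>\<langle>i,i+1| + |i+1,i\<rangle>\<langle>i+1,i|)\<close> with
  \<open>\<Phi> = \<Sum>\<^sub>i |i,i\<rangle>\<close>, and \<open>U3\<close> its partial transpose.\<close>
definition U3 :: "(nat \<Rightarrow> nat \<Rightarrow> real) list" where
  "U3 = [single_entry 2 0 0, single_entry 2 1 1, single_entry (-4) 2 2,
     \<lambda>i j. single_entry 4 0 1 i j + single_entry 1 1 0 i j,
     \<lambda>i j. single_entry (-8) 1 2 i j + single_entry 1 2 1 i j,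
     \<lambda>i j. single_entry 4 2 0 i j + single_entry (-2) 0 2 i j]"

definition V3 :: "(nat \<Rightarrow> nat \<Rightarrow> real) list" where
  "V3 = [\<lambda>i j. single_entry 2 0 0 i j + single_entry 2 1 1 i j + single_entry (-4) 2 2 i j,
     single_entry 4 0 1, single_entry 1 1 0, single_entry (-8) 1 2, single_entry 1 2 1, single_entry 4 2 0, single_entry (-2) 0 2]"

text \<open>\<open>V24\<close> describes Horodecki's family of \<open>2 \<times> 4\<close> states at parameter \<open>b = 8/17\<close> (chosen to make all
  square roots rational), with the sign of the second column changed, and \<open>U24\<close> its partial transpose.\<close>
definition U24 :: "(nat \<Rightarrow> nat \<Rightarrow> real) list" where
  "U24 = [single_entry 4 0 0,
     \<lambda>i j. single_entry (-4) 0 1 i j + single_entry 4 1 0 i j,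
     \<lambda>i j. single_entry 4 0 2 i j + single_entry (-4) 1 1 i j,
     \<lambda>i j. single_entry 4 0 3 i j + single_entry 4 1 2 i j,
     \<lambda>i j. single_entry 3 1 0 i j + single_entry 5 1 3 i j]"

definition V24 :: "(nat \<Rightarrow> nat \<Rightarrow> real) list" where
  "V24 = [\<lambda>i j. single_entry 4 0 0 i j + single_entry (-4) 1 1 i j,
     \<lambda>i j. single_entry (-4) 0 1 i j + single_entry 4 1 2 i j,
     \<lambda>i j. single_entry 4 0 2 i j + single_entry 4 1 3 i j,
     single_entry 4 0 3,
     \<lambda>i j. single_entry 5 1 0 i j + single_entry 3 1 3 i j]"

text \<open>For checking identities over all natural indices: in its \<open>Suc\<close> form the
  last case is visibly outside the block, where the entries vanish.\<close>

lemma nat_cases_Suc2: "(i::nat) = 0 \<or> i = 1 \<or> (\<exists>k. i = Suc (Suc k))"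
  by (metis One_nat_def not0_implies_Suc)

lemma nat_cases_Suc3: "(i::nat) = 0 \<or> i = 1 \<or> i = 2 \<or> (\<exists>k. i = Suc (Suc (Suc k)))"
  by (metis nat_cases_Suc2 numeral_2_eq_2 not0_implies_Suc)

lemma nat_cases_Suc4: "(i::nat) = 0 \<or> i = 1 \<or> i = 2 \<or> i = 3 \<or> (\<exists>k. i = Suc (Suc (Suc (Suc k))))"
  by (metis nat_cases_Suc3 numeral_3_eq_3 not0_implies_Suc)

lemma U3_V3: "(\<Sum>A\<leftarrow>U3. A i' j * A i j') = (\<Sum>A\<leftarrow>V3. A i j * A i' j')"
  using nat_cases_Suc3[of i] nat_cases_Suc3[of j] nat_cases_Suc3[of i'] nat_cases_Suc3[of j']
  unfolding U3_def V3_def by (elim disjE exE; simp add: single_entry_def)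

lemma U24_V24: "(\<Sum>A\<leftarrow>U24. A i' j * A i j') = (\<Sum>A\<leftarrow>V24. A i j * A i' j')"
  using nat_cases_Suc2[of i] nat_cases_Suc4[of j] nat_cases_Suc2[of i'] nat_cases_Suc4[of j']
  unfolding U24_def V24_def by (elim disjE exE; simp add: single_entry_def)

text \<open>The relations \<open>u\<close> form a cycle. Multiplied together they equate the product
  of all six variables with 64 times itself; 64 = 4^3 stems from the unequal weights 16 and 1, while
  the column factors cancel around the cycle. So some diagonal product is 0, \<open>v\<close>
  spreads this to all three since conjugation preserves zeros, and \<open>u\<close> gives the
  rest.\<close>

lemma rigid3_algebra:
  fixes x0 x1 x2 z0 z1 z2 y0 y1 y2 :: complex
  assumes z: "z0 = cnj x0" "z1 = cnj x1" "z2 = cnj x2"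
    and u: "x0 * y1 = 4 * (x1 * y0)" "x1 * y2 = - 8 * (x2 * y1)" "x2 * y0 = - 2 * (x0 * y2)"
    and v: "z0 * y0 = z1 * y1" "z2 * y2 = - 2 * (z1 * y1)"
  shows "(x0 = 0 \<and> x1 = 0 \<and> x2 = 0) \<or> (y0 = 0 \<and> y1 = 0 \<and> y2 = 0)"
proof -
  have "(x0 * y1) * (x1 * y2) * (x2 * y0) = 64 * ((x1 * y0) * (x2 * y1) * (x0 * y2))"
    unfolding u by (simp add: algebra_simps)
  then have "x0 * x1 * x2 * y0 * y1 * y2 = 0"
    by (simp add: algebra_simps)
  then have "x0 * y0 = 0 \<or> x1 * y1 = 0 \<or> x2 * y2 = 0" by auto
  then have "z0 * y0 = 0 \<or> z1 * y1 = 0 \<or> z2 * y2 = 0" using z by auto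
  then have "z0 * y0 = 0 \<and> z1 * y1 = 0 \<and> z2 * y2 = 0" using v by auto
  then have "x0 * y0 = 0 \<and> x1 * y1 = 0 \<and> x2 * y2 = 0" using z by auto
  then show ?thesis using u by auto
qed

lemma null_edge_state_3:
  assumes mn: "3 \<le> m" "3 \<le> n"
    and dual: "\<And>j j'. j < n \<Longrightarrow> j' < n \<Longrightarrow> (\<Sum>b<n. g j b * f j' b) = (if j = j' then 1 else 0)"
    and dual': "\<And>b b'. b < n \<Longrightarrow> b' < n \<Longrightarrow> (\<Sum>j<n. g j b * f j b') = (if b = b' then 1 else 0)"
    and \<psi>: "\<And>a j. a < 3 \<Longrightarrow> j < n \<Longrightarrow> (\<Sum>b<n. cnj (\<psi> (a, b)) * f j b) = (if a = j then 1 else 0)"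
  shows "null_edge_state m n \<psi>"
proof (rule null_edge_state_frame[OF U3_V3 dual dual' mn \<psi>])
  show "A a j = 0" if "A \<in> set V3" "3 \<le> a" for A a j
    using that by (auto simp: V3_def single_entry_def)
  show "(\<Sum>a<3. A a a) = 0" if "A \<in> set V3" for A
    using that by (auto simp: V3_def single_entry_def eval_nat_numeral)
  show "single_entry 2 0 0 \<in> set U3" by (simp add: U3_def)
  show "0 < m" "0 < n" using mn by auto
  show "single_entry 2 0 0 0 0 \<noteq> 0" by (simp add: single_entry_def)
  fix x y i j
  assume U: "orthogonal_to_kernel m n U3 x y" and V: "orthogonal_to_kernel m n V3 (\<lambda>i. cnj (x i)) y"
    and ij: "i < m" "j < n"
  have less: "0 < m" "1 < m" "2 < m" "0 < n" "1 < n" "2 < n" using mn by auto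
  have u1: "x 0 * y 1 = 4 * (x 1 * y 0)"
    using orthogonal_to_kernelD[OF U, of 1 0 1 "-4" 1 0 0 0 0] less
    by (simp add: annihilates_def U3_def single_entry_def)
  have u2: "x 1 * y 2 = - 8 * (x 2 * y 1)"
    using orthogonal_to_kernelD[OF U, of 1 1 2 8 2 1 0 0 0] less
    by (simp add: annihilates_def U3_def single_entry_def eq_neg_iff_add_eq_0)
  have u3: "x 2 * y 0 = - 2 * (x 0 * y 2)"
    using orthogonal_to_kernelD[OF U, of 1 2 0 2 0 2 0 0 0] less
    by (simp add: annihilates_def U3_def single_entry_def eq_neg_iff_add_eq_0)
  have v1: "cnj (x 0) * y 0 = cnj (x 1) * y 1"
    using orthogonal_to_kernelD[OF V, of 1 0 0 "-1" 1 1 0 0 0] less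
    by (simp add: annihilates_def V3_def single_entry_def)
  have v2: "cnj (x 2) * y 2 = - 2 * (cnj (x 1) * y 1)"
    using orthogonal_to_kernelD[OF V, of 1 2 2 2 1 1 0 0 0] less
    by (simp add: annihilates_def V3_def single_entry_def eq_neg_iff_add_eq_0)
  have alg: "(x 0 = 0 \<and> x 1 = 0 \<and> x 2 = 0) \<or> (y 0 = 0 \<and> y 1 = 0 \<and> y 2 = 0)"
    by (rule rigid3_algebra[OF refl refl refl u1 u2 u3 v1 v2])
  show "x i * y j = 0"
  proof (cases "i < 3 \<and> j < 3")
    case True
    then have "i = 0 \<or> i = 1 \<or> i = 2" "j = 0 \<or> j = 1 \<or> j = 2" by auto
    then show ?thesis using alg by auto
  next
    case False
    then show ?thesis
      by (intro orthogonal_to_kernel_entry[OF U ij]) (auto simp: U3_def single_entry_def)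
  qed
qed

text \<open>For nonzero x0 and x1 let t = x0 / x1 and let s be its conjugate. Then \<open>u\<close>
  yields y2 = t y3 and y1 = -t^2 y3. If y3 were nonzero, the second relation of \<open>v\<close>
  would give s t = 1, the third y0 = 0 and the first y1 = 0, a contradiction. If only one of x0, x1
  is 0, what is left are linear equations that force y = 0.\<close>

lemma rigid24_algebra:
  fixes x0 x1 y0 y1 y2 y3 :: complex
  assumes u: "x0 * y2 = - (x1 * y1)" "x0 * y3 = x1 * y2" "5 * (x0 * y1) + 5 * (x1 * y0) = 3 * (x1 * y3)"
    and v: "z0 * y0 = - (z1 * y1)" "z0 * y1 = - (z1 * y2)" "5 * (z0 * y2) + 3 * (z1 * y0) = 5 * (z1 * y3)"
    and z: "z0 = cnj x0" "z1 = cnj x1"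
  shows "(x0 = 0 \<and> x1 = 0) \<or> (y0 = 0 \<and> y1 = 0 \<and> y2 = 0 \<and> y3 = 0)"
proof (cases "x0 = 0 \<or> x1 = 0")
  case True
  then show ?thesis
  proof
    assume x0: "x0 = 0"
    show ?thesis
    proof (cases "x1 = 0")
      case False
      have "y1 = 0" "y2 = 0" "5 * y0 = 3 * y3" "3 * y0 = 5 * y3"
        using u v z x0 False by (auto simp: algebra_simps)
      \<comment> \<open>The two remaining equations for y0 and y3 have determinant of absolute value
        25 - 9.\<close>
      moreover have "5 * (5 * y0) = 3 * (3 * y0)"
        unfolding calculation(3,4) by simp
      then have "y0 = 0" by simp
      ultimately show ?thesis by simp
    qed (simp add: x0)
  next
    assume x1: "x1 = 0"
    then show ?thesis using u v z by auto
  qed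
next
  case False
  define t where "t = x0 / x1"
  define s where "s = cnj t"
  have s: "z0 = s * z1" and t: "x0 = t * x1" using False by (auto simp: t_def s_def z)
  have ne: "x1 \<noteq> 0" "z1 \<noteq> 0" "t \<noteq> 0" "s \<noteq> 0" using False by (auto simp: z t_def s_def)
  have U: "t * y2 = - y1" "t * y3 = y2" "5 * (t * y1) + 5 * y0 = 3 * y3"
  proof -
    have "x1 * (t * y2) = x1 * (- y1)" "x1 * (t * y3) = x1 * y2"
      "x1 * (5 * (t * y1) + 5 * y0) = x1 * (3 * y3)"
      using u unfolding t by (simp_all add: algebra_simps)
    then show "t * y2 = - y1" "t * y3 = y2" "5 * (t * y1) + 5 * y0 = 3 * y3"
      unfolding mult_left_cancel[OF ne(1)] by blast+
  qed
  have V: "s * y0 = - y1" "s * y1 = - y2" "5 * (s * y2) + 3 * y0 = 5 * y3"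
  proof -
    have "z1 * (s * y0) = z1 * (- y1)" "z1 * (s * y1) = z1 * (- y2)"
      "z1 * (5 * (s * y2) + 3 * y0) = z1 * (5 * y3)"
      using v unfolding s by (simp_all add: algebra_simps)
    then show "s * y0 = - y1" "s * y1 = - y2" "5 * (s * y2) + 3 * y0 = 5 * y3"
      unfolding mult_left_cancel[OF ne(2)] by blast+
  qed
  show ?thesis
  proof (cases "y3 = 0")
    case True
    then have "y2 = 0" "y1 = 0" using U by auto
    then show ?thesis using True U by auto
  next
    case y3: False
    have y2: "y2 = t * y3" and y1: "y1 = - (t * t * y3)" using U by (auto simp: algebra_simps)
    have "s * t * t * y3 = t * y3" using V(2) y1 y2 by (simp add: algebra_simps)
    then have st: "s * t = 1" using y3 ne by simp
    have "5 * (s * (t * y3)) + 3 * y0 = 5 * y3" using V(3) y2 by simp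
    then have "y0 = 0" using st by (simp add: mult.assoc[symmetric])
    then have "y1 = 0" using V by simp
    then show ?thesis using y1 y3 ne by simp
  qed
qed

lemma null_edge_state_24:
  assumes mn: "2 \<le> m" "4 \<le> n"
    and dual: "\<And>j j'. j < n \<Longrightarrow> j' < n \<Longrightarrow> (\<Sum>b<n. g j b * f j' b) = (if j = j' then 1 else 0)"
    and dual': "\<And>b b'. b < n \<Longrightarrow> b' < n \<Longrightarrow> (\<Sum>j<n. g j b * f j b') = (if b = b' then 1 else 0)"
    and \<psi>: "\<And>a j. a < 2 \<Longrightarrow> j < n \<Longrightarrow> (\<Sum>b<n. cnj (\<psi> (a, b)) * f j b) = (if a = j then 1 else 0)"
  shows "null_edge_state m n \<psi>"
proof (rule null_edge_state_frame[OF U24_V24 dual dual' mn(1) _ \<psi>])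
  show "A a j = 0" if "A \<in> set V24" "2 \<le> a" for A a j
    using that by (auto simp: V24_def single_entry_def)
  show "(\<Sum>a<2. A a a) = 0" if "A \<in> set V24" for A
    using that by (auto simp: V24_def single_entry_def eval_nat_numeral)
  show "single_entry 4 0 0 \<in> set U24" by (simp add: U24_def)
  show "0 < m" "0 < n" "2 \<le> n" using mn by auto
  show "single_entry 4 0 0 0 0 \<noteq> 0" by (simp add: single_entry_def)
  fix x y i j
  assume U: "orthogonal_to_kernel m n U24 x y" and V: "orthogonal_to_kernel m n V24 (\<lambda>i. cnj (x i)) y"
    and ij: "i < m" "j < n"
  have less: "0 < m" "1 < m" "0 < n" "1 < n" "2 < n" "3 < n" using mn by auto
  have u1: "x 0 * y 2 = - (x 1 * y 1)"
    using orthogonal_to_kernelD[OF U, of 1 0 2 1 1 1 0 0 0] less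
    by (simp add: annihilates_def U24_def single_entry_def eq_neg_iff_add_eq_0)
  have u2: "x 0 * y 3 = x 1 * y 2"
    using orthogonal_to_kernelD[OF U, of 1 0 3 "-1" 1 2 0 0 0] less
    by (simp add: annihilates_def U24_def single_entry_def)
  have u3: "5 * (x 0 * y 1) + 5 * (x 1 * y 0) = 3 * (x 1 * y 3)"
    using orthogonal_to_kernelD[OF U, of 5 0 1 5 1 0 "-3" 1 3] less
    by (simp add: annihilates_def U24_def single_entry_def algebra_simps)
  have v1: "cnj (x 0) * y 0 = - (cnj (x 1) * y 1)"
    using orthogonal_to_kernelD[OF V, of 1 0 0 1 1 1 0 0 0] less
    by (simp add: annihilates_def V24_def single_entry_def eq_neg_iff_add_eq_0)
  have v2: "cnj (x 0) * y 1 = - (cnj (x 1) * y 2)"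
    using orthogonal_to_kernelD[OF V, of 1 0 1 1 1 2 0 0 0] less
    by (simp add: annihilates_def V24_def single_entry_def eq_neg_iff_add_eq_0)
  have v3: "5 * (cnj (x 0) * y 2) + 3 * (cnj (x 1) * y 0) = 5 * (cnj (x 1) * y 3)"
    using orthogonal_to_kernelD[OF V, of 5 0 2 3 1 0 "-5" 1 3] less
    by (simp add: annihilates_def V24_def single_entry_def algebra_simps)
  have alg: "(x 0 = 0 \<and> x 1 = 0) \<or> (y 0 = 0 \<and> y 1 = 0 \<and> y 2 = 0 \<and> y 3 = 0)"
    by (rule rigid24_algebra[OF u1 u2 u3 v1 v2 v3 refl refl])
  show "x i * y j = 0"
  proof (cases "i < 2 \<and> j < 4")
    case True
    then have "i = 0 \<or> i = 1" "j = 0 \<or> j = 1 \<or> j = 2 \<or> j = 3" by auto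
    then show ?thesis using alg by auto
  next
    case False
    then show ?thesis
      by (intro orthogonal_to_kernel_entry[OF U ij]) (auto simp: U24_def single_entry_def)
  qed
qed

section \<open>Generic vectors\<close>

text \<open>A singular shift makes -t an eigenvalue of \<open>G\<close>, and there are finitely many
  of these.\<close>

lemma invertible_shift:
  fixes G :: "complex mat"
  assumes G: "G \<in> carrier_mat n n"
  shows "finite {t::real. \<not> (\<exists>B \<in> carrier_mat n n. (G + of_real t \<cdot>\<^sub>m 1\<^sub>m n) * B = 1\<^sub>m n \<and> B * (G + of_real t \<cdot>\<^sub>m 1\<^sub>m n) = 1\<^sub>m n)}"
    (is "finite ?T")
proof (rule finite_subset)
  show "finite ((\<lambda>t::real. - complex_of_real t) -` spectrum G)"
    by (intro finite_vimageI card_finite_spectrum(1)[OF G]) (auto simp: inj_def)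
  show "?T \<subseteq> (\<lambda>t::real. - complex_of_real t) -` spectrum G"
  proof (intro subsetI vimageI2)
    fix t assume t: "t \<in> ?T"
    define A where "A = G + complex_of_real t \<cdot>\<^sub>m 1\<^sub>m n"
    have A: "A \<in> carrier_mat n n" using G by (simp add: A_def)
    have "det A = 0"
    proof (rule ccontr)
      assume d: "det A \<noteq> 0"
      define B where "B = inverse (det A) \<cdot>\<^sub>m adj_mat A"
      have "B \<in> carrier_mat n n" "A * B = 1\<^sub>m n" "B * A = 1\<^sub>m n"
        using adj_mat[OF A] A d by (auto simp: B_def mult_smult_distrib[of _ n n _ n] mult_smult_assoc_mat[of _ n n _ n])
      then show False using t by (auto simp: A_def)
    qed
    then obtain v where v: "v \<in> carrier_vec n" "v \<noteq> 0\<^sub>v n" "A *\<^sub>v v = 0\<^sub>v n"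
      using det_0_iff_vec_prod_zero_field[OF A] by blast
    have Av: "A *\<^sub>v v = G *\<^sub>v v + of_real t \<cdot>\<^sub>v v"
    proof -
      have "(of_real t \<cdot>\<^sub>m 1\<^sub>m n) *\<^sub>v v = complex_of_real t \<cdot>\<^sub>v v"
        using v(1) by (intro eq_vecI) auto
      then show ?thesis
        using G v(1) by (simp add: A_def add_mult_distrib_mat_vec[of _ n n])
    qed
    have "G *\<^sub>v v = - complex_of_real t \<cdot>\<^sub>v v"
    proof (intro eq_vecI)
      fix i assume "i < dim_vec (- complex_of_real t \<cdot>\<^sub>v v)"
      then have i: "i < n" using v(1) by simp
      have "(G *\<^sub>v v + of_real t \<cdot>\<^sub>v v) $ i = 0" using v(3) i unfolding Av by simp
      then show "(G *\<^sub>v v) $ i = (- complex_of_real t \<cdot>\<^sub>v v) $ i"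
        using i v(1) G by (simp add: eq_neg_iff_add_eq_0)
    qed (use v(1) G in simp)
    then have "eigenvector G v (- complex_of_real t)"
      using v G by (simp add: eigenvector_def)
    then show "- complex_of_real t \<in> spectrum G"
      by (auto simp: spectrum_def eigenvalue_def)
  qed
qed

lemma dual_frame_exists:
  fixes \<psi> :: "nat \<times> nat \<Rightarrow> complex"
  assumes r: "r \<le> n"
  shows "finite {t::real. \<not> (\<exists>f g.
     (\<forall>j<n. \<forall>j'<n. (\<Sum>b<n. g j b * f j' b) = (if j = j' then 1 else 0)) \<and>
     (\<forall>b<n. \<forall>b'<n. (\<Sum>j<n. g j b * f j b') = (if b = b' then 1 else 0)) \<and>
     (\<forall>a<r. \<forall>j<n. (\<Sum>b<n. cnj (\<psi> (a, b) + of_real t * (if a = b then 1 else 0)) * f j b) = (if a = j then 1 else 0)))}"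
    (is "finite ?T")
proof -
  \<comment> \<open>After the shift, the first \<open>r\<close> rows are the conjugated rows of the
    perturbed \<psi>, and the others, t times unit vectors, complete them to a square matrix. Its
    rows are \<open>g\<close>, the columns of its inverse are \<open>f\<close>.\<close>
  define G where "G = Matrix.mat n n (\<lambda>(a, b). if a < r then cnj (\<psi> (a, b)) else 0)"
  have G: "G \<in> carrier_mat n n" by (simp add: G_def)
  show ?thesis
  proof (rule finite_subset[OF _ invertible_shift[OF G]], intro subsetI CollectI notI)
    fix t assume t: "t \<in> ?T"
    assume "\<exists>B \<in> carrier_mat n n. (G + of_real t \<cdot>\<^sub>m 1\<^sub>m n) * B = 1\<^sub>m n \<and> B * (G + of_real t \<cdot>\<^sub>m 1\<^sub>m n) = 1\<^sub>m n"
    then obtain B where B: "B \<in> carrier_mat n n" "(G + of_real t \<cdot>\<^sub>m 1\<^sub>m n) * B = 1\<^sub>m n"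
      "B * (G + of_real t \<cdot>\<^sub>m 1\<^sub>m n) = 1\<^sub>m n" by blast
    define A where "A = G + complex_of_real t \<cdot>\<^sub>m 1\<^sub>m n"
    have A: "A \<in> carrier_mat n n" using G by (simp add: A_def)
    have prod: "(M * M') $$ (i, j) = (\<Sum>k<n. M $$ (i, k) * M' $$ (k, j))"
      if "M \<in> carrier_mat n n" "M' \<in> carrier_mat n n" "i < n" "j < n" for M M' :: "complex mat" and i j
      using that by (auto simp: scalar_prod_def atLeast0LessThan intro!: sum.cong)
    define g where "g j b = A $$ (j, b)" for j b
    define f where "f j b = B $$ (b, j)" for j b
    have "(\<Sum>b<n. g j b * f j' b) = (if j = j' then 1 else 0)" if "j < n" "j' < n" for j j'
      using arg_cong[OF B(2), of "\<lambda>M. M $$ (j, j')"] that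
      unfolding A_def[symmetric] by (simp add: prod[OF A B(1)] g_def f_def)
    moreover have "(\<Sum>j<n. g j b * f j b') = (if b = b' then 1 else 0)" if "b < n" "b' < n" for b b'
      using arg_cong[OF B(3), of "\<lambda>M. M $$ (b', b)"] that
      unfolding A_def[symmetric] by (simp add: prod[OF B(1) A] g_def f_def mult.commute eq_commute[of b b'])
    moreover have "g a b = cnj (\<psi> (a, b) + of_real t * (if a = b then 1 else 0))" if "a < r" "b < n" for a b
      using that r by (simp add: g_def A_def G_def)
    then have "(\<Sum>b<n. cnj (\<psi> (a, b) + of_real t * (if a = b then 1 else 0)) * f j b) = (\<Sum>b<n. g a b * f j b)"
      if "a < r" for a j
      using that by (intro sum.cong) auto
    ultimately have "\<exists>f g.
     (\<forall>j<n. \<forall>j'<n. (\<Sum>b<n. g j b * f j' b) = (if j = j' then 1 else 0)) \<and>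
     (\<forall>b<n. \<forall>b'<n. (\<Sum>j<n. g j b * f j b') = (if b = b' then 1 else 0)) \<and>
     (\<forall>a<r. \<forall>j<n. (\<Sum>b<n. cnj (\<psi> (a, b) + of_real t * (if a = b then 1 else 0)) * f j b) = (if a = j then 1 else 0))"
      using r by (intro exI[of _ f] exI[of _ g]) simp
    then show False using t unfolding mem_Collect_eq by (rule notE[rotated])
  qed
qed

lemma sum_grid_swap: "(\<Sum>i\<in>grid n m. F i) = (\<Sum>i\<in>grid m n. F (prod.swap i))"
  by (rule sum.reindex_bij_witness[of _ prod.swap prod.swap]) (auto simp: grid_def)

lemma sform_swap:
  "sform (grid n m) (\<lambda>i j. A (prod.swap i) (prod.swap j)) x y
    = sform (grid m n) A (\<lambda>i. x (prod.swap i)) (\<lambda>i. y (prod.swap i))"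
  unfolding sform_def by (simp add: sum_grid_swap[where n = n and m = m])

lemma sform_transpose:
  "sform I (\<lambda>i j. A j i) x y = sform I A (\<lambda>i. cnj (y i)) (\<lambda>i. cnj (x i))"
  unfolding sform_def by (subst sum.swap) (simp add: ac_simps)

lemma swap_grid: "prod.swap i \<in> grid m n \<longleftrightarrow> i \<in> grid n m"
  by (cases i) (auto simp: grid_def)

text \<open>Exchanging the factors turns a transposition of the first into one of the second. The
  two differ by a full transposition, which is why \<psi> is conjugated.\<close>

lemma null_edge_state_swap:
  assumes "null_edge_state m n \<psi>"
  shows "null_edge_state n m (\<lambda>i. cnj (\<psi> (prod.swap i)))"
proof -
  obtain Y where Y: "psd_on (grid m n) Y" "psd_on (grid m n) (pt Y)"
    "sform (grid m n) (pt Y) \<psi> \<psi> = 0" "\<not> sep_cone m n Y"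
    using assms unfolding null_edge_state_def by blast
  define Y' where "Y' i j = Y (prod.swap i) (prod.swap j)" for i j
  have ptY': "pt Y' = (\<lambda>i j. pt Y (prod.swap j) (prod.swap i))"
    by (auto simp: pt_def Y'_def fun_eq_iff)
  have sform': "sform (grid n m) (pt Y') x x
    = sform (grid m n) (pt Y) (\<lambda>i. cnj (x (prod.swap i))) (\<lambda>i. cnj (x (prod.swap i)))" for x
    unfolding ptY' sform_transpose[of _ "\<lambda>i j. pt Y (prod.swap i) (prod.swap j)"] sform_swap ..
  have "psd_on (grid n m) Y'"
    using Y(1) unfolding psd_on_def Y'_def sform_swap herm_on_def by (meson swap_grid)
  moreover have "herm_on (grid n m) (pt Y')"
    using Y(2) unfolding psd_on_def ptY' herm_on_def by (meson swap_grid)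
  then have "psd_on (grid n m) (pt Y')"
    using Y(2) unfolding psd_on_def sform' by blast
  moreover have "sform (grid n m) (pt Y') (\<lambda>i. cnj (\<psi> (prod.swap i))) (\<lambda>i. cnj (\<psi> (prod.swap i))) = 0"
    unfolding sform' using Y(3) by simp
  moreover have "\<not> sep_cone n m Y'"
  proof
    assume "sep_cone n m Y'"
    then obtain k :: nat and v w where vw: "\<forall>i\<in>grid n m. \<forall>j\<in>grid n m.
       Y' i j = (\<Sum>l<k. prodv (v l) (w l) i * cnj (prodv (v l) (w l) j))"
      unfolding sep_cone_def by blast
    have ps: "prodv (v l) (w l) (prod.swap i) = prodv (w l) (v l) i" for l i
      by (cases i) simp
    have "sep_cone m n Y"
    proof (rule sep_coneI[where k = k and v = w and w = v])
      fix i j assume "i \<in> grid m n" "j \<in> grid m n"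
      then have "Y' (prod.swap i) (prod.swap j)
        = (\<Sum>l<k. prodv (v l) (w l) (prod.swap i) * cnj (prodv (v l) (w l) (prod.swap j)))"
        using vw swap_grid by blast
      then show "Y i j = (\<Sum>l<k. prodv (w l) (v l) i * cnj (prodv (w l) (v l) j))"
        by (simp add: Y'_def ps)
    qed
    then show False using Y(4) by blast
  qed
  ultimately show ?thesis unfolding null_edge_state_def by blast
qed

lemma null_edge_state_generic_aux:
  assumes "3 \<le> m \<and> 3 \<le> n \<or> 2 \<le> m \<and> 4 \<le> n"
  shows "finite {t::real. \<not> null_edge_state m n (\<lambda>i. \<psi> i + of_real t * (if fst i = snd i then 1 else 0))}"
proof -
  obtain r :: nat where r: "r = 3 \<and> 3 \<le> m \<and> 3 \<le> n \<or> r = 2 \<and> 2 \<le> m \<and> 4 \<le> n" using assms by blast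
  then have "r \<le> n" by auto
  show ?thesis
  proof (rule finite_subset[OF _ dual_frame_exists[OF \<open>r \<le> n\<close>, of \<psi>]], intro subsetI CollectI notI)
    fix t
    let ?\<psi> = "\<lambda>i. \<psi> i + of_real t * (if fst i = snd i then 1 else 0)"
    assume t: "t \<in> {t::real. \<not> null_edge_state m n (\<lambda>i. \<psi> i + of_real t * (if fst i = snd i then 1 else 0))}"
    assume "\<exists>f g.
     (\<forall>j<n. \<forall>j'<n. (\<Sum>b<n. g j b * f j' b) = (if j = j' then 1 else 0)) \<and>
     (\<forall>b<n. \<forall>b'<n. (\<Sum>j<n. g j b * f j b') = (if b = b' then 1 else 0)) \<and>
     (\<forall>a<r. \<forall>j<n. (\<Sum>b<n. cnj (\<psi> (a, b) + of_real t * (if a = b then 1 else 0)) * f j b) = (if a = j then 1 else 0))"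
    then obtain f g where
      1: "\<And>j j'. j < n \<Longrightarrow> j' < n \<Longrightarrow> (\<Sum>b<n. g j b * f j' b) = (if j = j' then 1 else 0)" and
      2: "\<And>b b'. b < n \<Longrightarrow> b' < n \<Longrightarrow> (\<Sum>j<n. g j b * f j b') = (if b = b' then 1 else 0)" and
      3: "\<And>a j. a < r \<Longrightarrow> j < n \<Longrightarrow> (\<Sum>b<n. cnj (\<psi> (a, b) + of_real t * (if a = b then 1 else 0)) * f j b) = (if a = j then 1 else 0)"
      by blast
    have "null_edge_state m n ?\<psi>"
      using r
    proof
      assume r: "r = 3 \<and> 3 \<le> m \<and> 3 \<le> n"
      then show ?thesis
        by (intro null_edge_state_3[of m n g f]) (use 1 2 3 in simp_all)
    next
      assume r: "r = 2 \<and> 2 \<le> m \<and> 4 \<le> n"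
      then show ?thesis
        by (intro null_edge_state_24[of m n g f]) (use 1 2 3 in simp_all)
    qed
    then show False using t by simp
  qed
qed

lemma null_edge_state_generic:
  assumes "2 \<le> m" "2 \<le> n" "6 < m * n"
  shows "finite {t::real. \<not> null_edge_state m n (\<lambda>i. \<psi> i + of_real t * (if fst i = snd i then 1 else 0))}"
proof (cases "3 \<le> m \<and> 3 \<le> n \<or> 2 \<le> m \<and> 4 \<le> n")
  case True
  then show ?thesis by (rule null_edge_state_generic_aux)
next
  case False
  \<comment> \<open>The only other pair that misses both sizes is 2 x 3, which
    \<open>6 < m * n\<close> excludes. With \<open>n = 2\<close> the exchanged system is at least 2
    x 4.\<close>
  have "n = 2"
  proof (rule ccontr)
    assume "n \<noteq> 2"
    then have "m = 2" "n = 3" using False assms by auto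
    then show False using assms by simp
  qed
  then have nm: "3 \<le> n \<and> 3 \<le> m \<or> 2 \<le> n \<and> 4 \<le> m" using assms by auto
  have "null_edge_state m n (\<lambda>i. \<psi> i + of_real t * (if fst i = snd i then 1 else 0))"
    if "null_edge_state n m (\<lambda>i. cnj (\<psi> (prod.swap i)) + of_real t * (if fst i = snd i then 1 else 0))" for t :: real
  proof -
    have "(\<lambda>i. cnj (cnj (\<psi> (prod.swap (prod.swap i))) + of_real t * (if fst (prod.swap i) = snd (prod.swap i) then 1 else 0)))
      = (\<lambda>i. \<psi> i + of_real t * (if fst i = snd i then 1 else 0))"
      by (auto simp: fun_eq_iff)
    then show ?thesis using null_edge_state_swap[OF that] by simp
  qed
  then show ?thesis
    by (intro finite_subset[OF _ null_edge_state_generic_aux[OF nm, of "\<lambda>i. cnj (\<psi> (prod.swap i))"]]) blast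
qed

section \<open>Tilted witnesses and the two cases\<close>

text \<open>Partial transposition is self-adjoint for the trace pairing, being an involution of the
  pairs of indices summed over.\<close>

lemma tr_prod_pt: "tr_prod (grid m n) (pt A) B = tr_prod (grid m n) A (pt B)"
  unfolding tr_prod_def sum.cartesian_product
  by (rule sum.reindex_bij_witness[of _ "\<lambda>(i, j). ((fst j, snd i), (fst i, snd j))" "\<lambda>(i, j). ((fst j, snd i), (fst i, snd j))"])
    (auto simp: grid_def pt_def)

lemma tr_prod_ketbra: "tr_prod I A (\<lambda>i j. x i * cnj (x j)) = sform I A x x"
  using tr_prod_gram[of I "\<lambda>i j. x i * cnj (x j)" "\<lambda>_. x" "{()}" A] by simp

lemma tr_prod_commute: "tr_prod I A B = tr_prod I B A"
  unfolding tr_prod_def by (subst sum.swap) (simp add: mult.commute)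

text \<open>The partial transpose of a product ketbra is the ketbra with the first factor
  conjugated. Hence partial transposes of positive operators are nonnegative on product
  vectors.\<close>

lemma sform_pt_prodv:
  "sform (grid m n) (pt A) (prodv a b) (prodv a b)
    = sform (grid m n) A (prodv (\<lambda>i. cnj (a i)) b) (prodv (\<lambda>i. cnj (a i)) b)"
proof -
  have "pt (\<lambda>i j. prodv a b i * cnj (prodv a b j))
    = (\<lambda>i j. prodv (\<lambda>i. cnj (a i)) b i * cnj (prodv (\<lambda>i. cnj (a i)) b j))"
    by (auto simp: pt_def fun_eq_iff)
  then show ?thesis
    by (metis tr_prod_ketbra tr_prod_pt)
qed

lemma herm_on_pt:
  assumes "herm_on (grid m n) A"
  shows "herm_on (grid m n) (pt A)"
  unfolding herm_on_def
proof (intro ballI)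
  fix i j assume "i \<in> grid m n" "j \<in> grid m n"
  then have "(fst j, snd i) \<in> grid m n" "(fst i, snd j) \<in> grid m n"
    by (auto simp: grid_def)
  then show "pt A i j = cnj (pt A j i)"
    unfolding pt_def using herm_onD[OF assms] by simp
qed

text \<open>\<open>Y\<close> certifies nondecomposability: no sum of a positive operator and the
  partial transpose of a positive one can be negative on it.\<close>

definition nondecomposable_certificate where
  "nondecomposable_certificate m n W Y \<longleftrightarrow> herm_on (grid m n) W \<and>
    (\<forall>a b. 0 \<le> Re (sform (grid m n) W (prodv a b) (prodv a b))) \<and>
    psd_on (grid m n) Y \<and> psd_on (grid m n) (pt Y) \<and> Re (tr_prod (grid m n) W Y) < 0"

lemma npt_witness:
  assumes mn: "2 \<le> m" "2 \<le> n" "6 < m * n"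
    and \<psi>: "Re (sform (grid m n) (pt X) \<psi> \<psi>) < 0"
  shows "\<exists>W Y. nondecomposable_certificate m n W Y \<and> Re (tr_prod (grid m n) W X) < 0"
proof -
  let ?G = "grid m n"
  define \<phi> where "\<phi> t i = \<psi> i + of_real t * (if fst i = snd i then 1 else 0)" for t i
  define q where "q t = Re (sform ?G (pt X) (\<phi> t) (\<phi> t))" for t
  have "continuous_on UNIV q"
    unfolding q_def sform_def \<phi>_def by (intro continuous_intros)
  then have "isCont q 0" by (simp add: continuous_on_eq_continuous_at)
  moreover have "\<phi> 0 = \<psi>" by (simp add: \<phi>_def fun_eq_iff)
  then have "q 0 < 0" using \<psi> by (simp add: q_def)
  ultimately have "eventually (\<lambda>t. q t < 0) (at 0)"
    unfolding isCont_def by (rule order_tendstoD(2))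
  then obtain \<delta> where \<delta>: "\<delta> > 0" "\<And>t. t \<noteq> 0 \<Longrightarrow> dist t 0 < \<delta> \<Longrightarrow> q t < 0"
    unfolding eventually_at by blast
  \<comment> \<open>Negativity on \<open>X\<close> holds on an interval of parameters, the kernel
    condition fails for finitely many; so both can be met.\<close>
  have "infinite ({0<..<\<delta>} - {t. \<not> null_edge_state m n (\<phi> t)})"
    using null_edge_state_generic[OF mn, of \<psi>] infinite_Ioo[OF \<delta>(1)]
    unfolding \<phi>_def by (intro Diff_infinite_finite)
  then obtain t where t: "t \<in> {0<..<\<delta>}" "null_edge_state m n (\<phi> t)"
    by (metis (mono_tags, lifting) DiffE finite.emptyI ex_in_conv mem_Collect_eq)
  have qt: "q t < 0" using \<delta>(2)[of t] t(1) by simp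
  obtain Y where Y: "psd_on ?G Y" "psd_on ?G (pt Y)" "sform ?G (pt Y) (\<phi> t) (\<phi> t) = 0" "\<not> sep_cone m n Y"
    using t(2) unfolding null_edge_state_def by blast
  have YH: "herm_on ?G Y" using Y(1) by (simp add: psd_on_def)
  obtain W1 where W1: "herm_on ?G W1" "\<forall>a b. 0 \<le> Re (sform ?G W1 (prodv a b) (prodv a b))"
    "Re (tr_prod ?G W1 Y) < 0"
    using separating_witness[OF YH Y(4)] by blast
  define K where "K i j = \<phi> t i * cnj (\<phi> t j)" for i j
  have trK: "tr_prod ?G (pt K) Z = sform ?G (pt Z) (\<phi> t) (\<phi> t)" for Z
    unfolding tr_prod_pt K_def by (subst tr_prod_commute) (rule tr_prod_ketbra)
  define c where "c = Re (tr_prod ?G W1 X)"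
  \<comment> \<open>\<open>c\<close> may be positive; this tilt is too small to cancel the negative
    value \<open>q t\<close>.\<close>
  define \<epsilon> where "\<epsilon> = - q t / (\<bar>c\<bar> + 1)"
  have \<epsilon>: "\<epsilon> > 0" unfolding \<epsilon>_def using qt by (intro divide_pos_pos) auto
  have "\<epsilon> * c < \<epsilon> * (\<bar>c\<bar> + 1)" using \<epsilon> by (intro mult_strict_left_mono) auto
  also have "\<dots> = - q t" by (simp add: \<epsilon>_def)
  finally have \<epsilon>c: "q t + \<epsilon> * c < 0" by simp
  define W where "W = (\<lambda>i j. pt K i j + of_real \<epsilon> * W1 i j)"
  have trW: "tr_prod ?G W Z = sform ?G (pt Z) (\<phi> t) (\<phi> t) + of_real \<epsilon> * tr_prod ?G W1 Z" for Z
    by (simp add: W_def tr_prod_add_left tr_prod_scale_left trK)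
  have KH: "herm_on ?G (pt K)" by (rule herm_on_pt) (simp add: herm_on_def K_def mult.commute)
  have "herm_on ?G W"
    unfolding herm_on_def W_def using herm_onD[OF KH] herm_onD[OF W1(1)] by simp
  moreover have "0 \<le> Re (sform ?G W (prodv a b) (prodv a b))" for a b
  proof -
    have "0 \<le> Re (sform ?G (pt K) (prodv a b) (prodv a b))"
      unfolding sform_pt_prodv K_def unfolding sform_ketbra_self by simp
    then show ?thesis using W1(2) \<epsilon>
      by (simp add: W_def sform_add_mat sform_scale_mat)
  qed
  \<comment> \<open>The kernel condition removes the untilted term, so the tilt alone decides the
    sign.\<close>
  moreover have "Re (tr_prod ?G W Y) < 0"
    using W1(3) \<epsilon> by (simp add: trW Y(3) mult_pos_neg)
  moreover have "Re (tr_prod ?G W X) < 0"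
    using \<epsilon>c by (simp add: trW q_def c_def)
  ultimately show ?thesis using Y(1,2) unfolding nondecomposable_certificate_def by blast
qed

text \<open>If one factor is one-dimensional, every vector is a product vector, so any Gram
  decomposition is separable.\<close>

lemma psd_on_degenerate_sep_cone:
  assumes X: "psd_on (grid m n) X" and mn: "m = 1 \<or> n = 1"
  shows "sep_cone m n X"
proof -
  obtain k :: nat and v where v: "\<forall>i\<in>grid m n. \<forall>j\<in>grid m n. X i j = (\<Sum>l<k. v l i * cnj (v l j))"
    using psd_on_gram_decomposition[OF finite_grid X] by blast
  from mn show ?thesis
  proof
    assume "m = 1"
    then have "prodv (\<lambda>_. 1) (\<lambda>b. v l (0, b)) i = v l i" if "i \<in> grid m n" for l i
      using that by (cases i) (auto simp: grid_def)
    then show ?thesis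
      using v by (intro sep_coneI[where k = k and v = "\<lambda>_ _. 1" and w = "\<lambda>l b. v l (0, b)"]) simp
  next
    assume "n = 1"
    then have "prodv (\<lambda>a. v l (a, 0)) (\<lambda>_. 1) i = v l i" if "i \<in> grid m n" for l i
      using that by (cases i) (auto simp: grid_def)
    then show ?thesis
      using v by (intro sep_coneI[where k = k and v = "\<lambda>l a. v l (a, 0)" and w = "\<lambda>_ _. 1"]) simp
  qed
qed

lemma nondecomposable_witness_exists:
  assumes mn: "0 < m" "0 < n" "6 < m * n" and X: "psd_on (grid m n) X" "\<not> sep_cone m n X"
  shows "\<exists>W Y. nondecomposable_certificate m n W Y \<and> Re (tr_prod (grid m n) W X) < 0"
proof (cases "psd_on (grid m n) (pt X)")
  case True
  have XH: "herm_on (grid m n) X" using X(1) by (simp add: psd_on_def)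
  obtain W where "herm_on (grid m n) W"
    "\<forall>a b. 0 \<le> Re (sform (grid m n) W (prodv a b) (prodv a b))"
    "Re (tr_prod (grid m n) W X) < 0"
    using separating_witness[OF XH X(2)] by blast
  \<comment> \<open>Here \<open>X\<close> serves as its own certificate.\<close>
  then show ?thesis using X(1) True unfolding nondecomposable_certificate_def by blast
next
  case False
  have "herm_on (grid m n) (pt X)" using X(1) by (intro herm_on_pt) (simp add: psd_on_def)
  then obtain \<psi> where "Re (sform (grid m n) (pt X) \<psi> \<psi>) < 0"
    using False unfolding psd_on_def by (meson not_less)
  moreover have "2 \<le> m" "2 \<le> n"
    using psd_on_degenerate_sep_cone[OF X(1)] X(2) mn by (auto intro: ccontr)
  ultimately show ?thesis by (intro npt_witness mn)
qed

section \<open>Matrices\<close>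

text \<open>With pairs as indices, partial transposition just exchanges components;
  \<open>div\<close> and \<open>mod\<close> enter only in the passage to matrices.\<close>

definition mat_fun :: "nat \<Rightarrow> complex mat \<Rightarrow> nat \<times> nat \<Rightarrow> nat \<times> nat \<Rightarrow> complex" where
  "mat_fun n M i j = M $$ (fst i * n + snd i, fst j * n + snd j)"

lemma grid_index_less:
  assumes "i \<in> grid m n"
  shows "fst i * n + snd i < m * n"
proof -
  have "fst i + 1 \<le> m" "snd i < n" using assms by (auto simp: grid_def)
  then have "(fst i + 1) * n \<le> m * n" by (intro mult_right_mono) auto
  then show ?thesis using \<open>snd i < n\<close> by simp
qed

lemma grid_index_div_mod:
  assumes "i \<in> grid m n"
  shows "(fst i * n + snd i) div n = fst i" "(fst i * n + snd i) mod n = snd i"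
  using assms by (auto simp: grid_def)

lemma grid_index_pair:
  assumes "i \<in> grid m n"
  shows "((fst i * n + snd i) div n, (fst i * n + snd i) mod n) = i"
  by (simp only: grid_index_div_mod[OF assms] prod.collapse)

lemma div_mod_in_grid:
  assumes "k < m * n"
  shows "(k div n, k mod n) \<in> grid m n"
proof -
  have "0 < n" using assms by (cases n) auto
  then show ?thesis using assms by (simp add: grid_def less_mult_imp_div_less)
qed

lemma sum_index_grid: "(\<Sum>k<m * n. F k) = (\<Sum>i\<in>grid m n. F (fst i * n + snd i))"
  by (rule sum.reindex_bij_witness[of _ "\<lambda>i. fst i * n + snd i" "\<lambda>k. (k div n, k mod n)"])
    (simp_all only: grid_index_pair grid_index_less div_mod_in_grid lessThan_iff fst_conv snd_conv div_mult_mod_eq)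

lemma mat_form_sform:
  assumes "M \<in> carrier_mat (m * n) (m * n)" "x \<in> carrier_vec (m * n)" "y \<in> carrier_vec (m * n)"
  shows "(M *\<^sub>v x) \<bullet>c y = sform (grid m n) (mat_fun n M) (\<lambda>i. y $ (fst i * n + snd i)) (\<lambda>i. x $ (fst i * n + snd i))"
proof -
  have "(M *\<^sub>v x) \<bullet>c y = (\<Sum>k<m * n. (\<Sum>l<m * n. M $$ (k, l) * x $ l) * cnj (y $ k))"
    using assms by (auto simp: scalar_prod_def atLeast0LessThan intro!: sum.cong)
  also have "\<dots> = (\<Sum>k<m * n. \<Sum>l<m * n. cnj (y $ k) * M $$ (k, l) * x $ l)"
    by (simp add: sum_distrib_left sum_distrib_right ac_simps)
  finally show ?thesis by (simp add: sum_index_grid sform_def mat_fun_def)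
qed

lemma herm_on_mat_fun: "hermitian (m * n) M \<Longrightarrow> herm_on (grid m n) (mat_fun n M)"
  unfolding hermitian_def herm_on_def mat_fun_def using grid_index_less by blast

lemma psd_on_mat_fun:
  assumes "psd (m * n) M"
  shows "psd_on (grid m n) (mat_fun n M)"
  unfolding psd_on_def
proof (intro conjI allI)
  have M: "hermitian (m * n) M" "M \<in> carrier_mat (m * n) (m * n)"
    using assms unfolding psd_def hermitian_def by blast+
  show "herm_on (grid m n) (mat_fun n M)" by (rule herm_on_mat_fun[OF M(1)])
  fix x :: "nat \<times> nat \<Rightarrow> complex"
  define u where "u = Matrix.vec (m * n) (\<lambda>k. x (k div n, k mod n))"
  have u: "u \<in> carrier_vec (m * n)" by (simp add: u_def)
  have ux: "u $ (fst i * n + snd i) = x i" if "i \<in> grid m n" for i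
    by (simp only: u_def index_vec[OF grid_index_less[OF that]] grid_index_pair[OF that])
  have "sform (grid m n) (mat_fun n M) x x = (M *\<^sub>v u) \<bullet>c u"
    unfolding mat_form_sform[OF M(2) u u] by (rule sform_cong) (simp_all add: ux)
  then show "0 \<le> Re (sform (grid m n) (mat_fun n M) x x)"
    using assms u by (simp add: psd_def)
qed

lemma mat_fun_ptrans:
  assumes "i \<in> grid m n" "j \<in> grid m n"
  shows "mat_fun n (ptrans m n Q) i j = pt (mat_fun n Q) i j"
  by (simp only: mat_fun_def ptrans_def pt_def index_mat(1)[OF grid_index_less[OF assms(1)] grid_index_less[OF assms(2)]]
      prod.case fst_conv snd_conv grid_index_div_mod[OF assms(1)] grid_index_div_mod[OF assms(2)])

lemma tensor_vec_prodv:
  assumes "i \<in> grid m n"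
  shows "tensor_vec m n v w $ (fst i * n + snd i) = prodv (\<lambda>a. v $ a) (\<lambda>b. w $ b) i"
  by (simp only: tensor_vec_def index_vec[OF grid_index_less[OF assms]] grid_index_div_mod[OF assms]
      prodv_def case_prod_unfold)

lemma mtrace_mult:
  assumes "A \<in> carrier_mat (m * n) (m * n)" "B \<in> carrier_mat (m * n) (m * n)"
  shows "mtrace (A * B) = tr_prod (grid m n) (mat_fun n A) (mat_fun n B)"
proof -
  have "mtrace (A * B) = (\<Sum>k<m * n. \<Sum>l<m * n. A $$ (k, l) * B $$ (l, k))"
    using assms by (auto simp: mtrace_def scalar_prod_def atLeast0LessThan intro!: sum.cong)
  then show ?thesis by (simp add: sum_index_grid tr_prod_def mat_fun_def)
qed

lemma normalized_vector:
  assumes d: "0 < (d::nat)"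
  shows "\<exists>u. unit_vec_in d u \<and> (\<forall>a<d. v a = of_real (sqrt (\<Sum>a<d. (cmod (v a))\<^sup>2)) * u $ a)"
proof -
  define s where "s = sqrt (\<Sum>a<d. (cmod (v a))\<^sup>2)"
  have s2: "s\<^sup>2 = (\<Sum>a<d. (cmod (v a))\<^sup>2)" by (simp add: s_def sum_nonneg)
  have norm: "Matrix.vec d f \<bullet>c Matrix.vec d f = of_real (\<Sum>a<d. (cmod (f a))\<^sup>2)" for f
    by (simp add: scalar_prod_def atLeast0LessThan complex_norm_square del: of_real_power)
  show ?thesis
  proof (cases "s = 0")
    case True
    \<comment> \<open>The norm factor is 0, so any unit vector will do; \<open>0 < d\<close>
      supplies the first basis vector.\<close>
    have "v a = 0" if "a < d" for a
      using s2 True that by (simp add: sum_nonneg_eq_0_iff)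
    moreover have "(\<Sum>a<d. (cmod (if a = 0 then 1 else 0))\<^sup>2) = (1::real)"
      using d by (simp add: if_distrib[of "\<lambda>u. (cmod u)\<^sup>2"] cong: if_cong)
    then have "unit_vec_in d (Matrix.vec d (\<lambda>a. if a = 0 then 1 else 0))"
      by (simp only: unit_vec_in_def norm) simp
    ultimately show ?thesis using True
      by (intro exI[of _ "Matrix.vec d (\<lambda>a. if a = 0 then 1 else 0)"]) (simp add: s_def)
  next
    case False
    have "(\<Sum>a<d. (cmod (v a / of_real s))\<^sup>2) = (\<Sum>a<d. (cmod (v a))\<^sup>2) / s\<^sup>2"
      by (simp add: norm_divide power_divide sum_divide_distrib)
    also have "\<dots> = 1" using False by (simp add: s2[symmetric])
    finally have "unit_vec_in d (Matrix.vec d (\<lambda>a. v a / of_real s))"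
      by (simp only: unit_vec_in_def norm) simp
    then show ?thesis using False
      by (intro exI[of _ "Matrix.vec d (\<lambda>a. v a / of_real s)"]) (simp add: s_def[symmetric])
  qed
qed

lemma separable_of_sep_cone:
  assumes mn: "0 < m" "0 < n" and \<rho>: "is_state (m * n) \<rho>" and sep: "sep_cone m n (mat_fun n \<rho>)"
  shows "separable m n \<rho>"
proof -
  have carrier: "\<rho> \<in> carrier_mat (m * n) (m * n)" and tr: "mtrace \<rho> = 1"
    using \<rho> unfolding is_state_def psd_def hermitian_def by blast+
  obtain k :: nat and v w where vw: "\<forall>i\<in>grid m n. \<forall>j\<in>grid m n.
     mat_fun n \<rho> i j = (\<Sum>l<k. prodv (v l) (w l) i * cnj (prodv (v l) (w l) j))"
    using sep unfolding sep_cone_def by blast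
  define s where "s l = sqrt (\<Sum>a<m. (cmod (v l a))\<^sup>2)" for l
  define r where "r l = sqrt (\<Sum>b<n. (cmod (w l b))\<^sup>2)" for l
  obtain v' where v': "\<And>l. unit_vec_in m (v' l)" "\<And>l a. a < m \<Longrightarrow> v l a = of_real (s l) * v' l $ a"
  proof -
    have "\<forall>l. \<exists>u. unit_vec_in m u \<and> (\<forall>a<m. v l a = of_real (s l) * u $ a)"
      using normalized_vector[OF mn(1)] unfolding s_def by blast
    from choice[OF this] obtain v' where "\<forall>l. unit_vec_in m (v' l) \<and> (\<forall>a<m. v l a = of_real (s l) * v' l $ a)"
      by blast
    then show ?thesis by (intro that[of v']) auto
  qed
  obtain w' where w': "\<And>l. unit_vec_in n (w' l)" "\<And>l b. b < n \<Longrightarrow> w l b = of_real (r l) * w' l $ b"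
  proof -
    have "\<forall>l. \<exists>u. unit_vec_in n u \<and> (\<forall>b<n. w l b = of_real (r l) * u $ b)"
      using normalized_vector[OF mn(2)] unfolding r_def by blast
    from choice[OF this] obtain w' where "\<forall>l. unit_vec_in n (w' l) \<and> (\<forall>b<n. w l b = of_real (r l) * w' l $ b)"
      by blast
    then show ?thesis by (intro that[of w']) auto
  qed
  \<comment> \<open>The squared norms removed from the vectors become the weights; each
    \<open>T l\<close> is a unit vector, so trace 1 makes them sum to 1.\<close>
  define p where "p l = (s l * r l)\<^sup>2" for l
  define T where "T l = tensor_vec m n (v' l) (w' l)" for l
  have T: "prodv (v l) (w l) i = of_real (s l * r l) * T l $ (fst i * n + snd i)" if "i \<in> grid m n" for l i
    using that v'(2) w'(2) unfolding T_def tensor_vec_prodv[OF that] by (cases i) (auto simp: grid_def)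
  have entry: "\<rho> $$ (i, j) = (\<Sum>l<k. of_real (p l) * ketbra (T l) $$ (i, j))"
    if ij: "i < m * n" "j < m * n" for i j
  proof -
    define i' where "i' = (i div n, i mod n)"
    define j' where "j' = (j div n, j mod n)"
    have g: "i' \<in> grid m n" "j' \<in> grid m n" using ij div_mod_in_grid by (auto simp: i'_def j'_def)
    have e: "fst i' * n + snd i' = i" "fst j' * n + snd j' = j" by (simp_all add: i'_def j'_def)
    have "\<rho> $$ (i, j) = mat_fun n \<rho> i' j'" by (simp add: mat_fun_def e)
    also have "\<dots> = (\<Sum>l<k. prodv (v l) (w l) i' * cnj (prodv (v l) (w l) j'))"
      using vw g by blast
    also have "\<dots> = (\<Sum>l<k. of_real (p l) * (T l $ i * cnj (T l $ j)))"
      unfolding T[OF g(1)] T[OF g(2)] e by (simp add: p_def power2_eq_square ac_simps)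
    also have "\<dots> = (\<Sum>l<k. of_real (p l) * ketbra (T l) $$ (i, j))"
      using ij by (simp add: ketbra_def T_def tensor_vec_def)
    finally show ?thesis .
  qed
  have norm1: "(\<Sum>i<m * n. ketbra (T l) $$ (i, i)) = 1" for l
  proof -
    have "(\<Sum>i<m * n. ketbra (T l) $$ (i, i)) = (\<Sum>i<m * n. T l $ i * cnj (T l $ i))"
      by (simp add: ketbra_def T_def tensor_vec_def)
    also have "\<dots> = (\<Sum>i\<in>grid m n. prodv (\<lambda>a. v' l $ a) (\<lambda>b. w' l $ b) i * cnj (prodv (\<lambda>a. v' l $ a) (\<lambda>b. w' l $ b) i))"
      by (simp add: sum_index_grid T_def tensor_vec_prodv)
    also have "\<dots> = (\<Sum>a<m. v' l $ a * cnj (v' l $ a)) * (\<Sum>b<n. w' l $ b * cnj (w' l $ b))"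
      by (simp add: sum_grid sum_product ac_simps)
    also have "(\<Sum>a<m. v' l $ a * cnj (v' l $ a)) = 1"
      using v'(1)[of l] by (auto simp: unit_vec_in_def scalar_prod_def atLeast0LessThan)
    also have "(\<Sum>b<n. w' l $ b * cnj (w' l $ b)) = 1"
      using w'(1)[of l] by (auto simp: unit_vec_in_def scalar_prod_def atLeast0LessThan)
    finally show ?thesis by simp
  qed
  have "1 = (\<Sum>i<m * n. \<rho> $$ (i, i))" using tr carrier by (simp add: mtrace_def)
  also have "\<dots> = (\<Sum>i<m * n. \<Sum>l<k. of_real (p l) * ketbra (T l) $$ (i, i))"
    by (simp add: entry)
  also have "\<dots> = (\<Sum>l<k. \<Sum>i<m * n. of_real (p l) * ketbra (T l) $$ (i, i))"
    by (rule sum.swap)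
  also have "\<dots> = of_real (\<Sum>l<k. p l)"
    by (simp add: sum_distrib_left[symmetric] norm1)
  finally have "complex_of_real (\<Sum>l<k. p l) = of_real 1" by simp
  then have "(\<Sum>l<k. p l) = 1" by (simp only: of_real_eq_iff)
  then show ?thesis
    unfolding separable_def
    using carrier entry v'(1) w'(1)
    by (intro exI[of _ k] exI[of _ p] exI[of _ v'] exI[of _ w'] conjI allI impI)
      (auto simp: p_def T_def)
qed

theorem theorem3:
  fixes m n :: nat and \<rho> :: "complex mat"
  assumes "0 < m" and "0 < n" and "m * n > 6"
    and "entangled m n \<rho>"
  shows "\<exists>W. entanglement_witness m n W \<and> \<not> decomposable m n W \<and>
             Re (mtrace (W * \<rho>)) < 0"
proof -
  let ?G = "grid m n"
  have \<rho>: "is_state (m * n) \<rho>" "psd (m * n) \<rho>" "\<rho> \<in> carrier_mat (m * n) (m * n)"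
    using assms(4) unfolding entangled_def is_state_def psd_def hermitian_def by blast+
  have "\<not> sep_cone m n (mat_fun n \<rho>)"
    using separable_of_sep_cone[OF assms(1,2) \<rho>(1)] assms(4) by (auto simp: entangled_def)
  then obtain F Y where cert: "nondecomposable_certificate m n F Y" and neg: "Re (tr_prod ?G F (mat_fun n \<rho>)) < 0"
    using nondecomposable_witness_exists[OF assms(1-3) psd_on_mat_fun[OF \<rho>(2)]] by blast
  have FH: "herm_on ?G F" and F_prod: "\<And>a b. 0 \<le> Re (sform ?G F (prodv a b) (prodv a b))"
    and Y: "psd_on ?G Y" "psd_on ?G (pt Y)" and FY: "Re (tr_prod ?G F Y) < 0"
    using cert unfolding nondecomposable_certificate_def by blast+
  define W where "W = Matrix.mat (m * n) (m * n) (\<lambda>(i, j). F (i div n, i mod n) (j div n, j mod n))"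
  have W: "W \<in> carrier_mat (m * n) (m * n)" by (simp add: W_def)
  have FW: "mat_fun n W i j = F i j" if "i \<in> ?G" "j \<in> ?G" for i j
    by (simp only: mat_fun_def W_def index_mat(1)[OF grid_index_less[OF that(1)] grid_index_less[OF that(2)]]
        prod.case grid_index_pair[OF that(1)] grid_index_pair[OF that(2)])
  have trW: "tr_prod ?G (mat_fun n W) Z = tr_prod ?G F Z" for Z
    unfolding tr_prod_def by (intro sum.cong refl) (simp add: FW)
  have "hermitian (m * n) W"
    unfolding hermitian_def using W herm_onD[OF FH div_mod_in_grid div_mod_in_grid] by (simp add: W_def)
  moreover have "0 \<le> Re ((W *\<^sub>v tensor_vec m n a b) \<bullet>c tensor_vec m n a b)" for a b
  proof -
    have t: "tensor_vec m n a b \<in> carrier_vec (m * n)" by (simp add: tensor_vec_def)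
    have "(W *\<^sub>v tensor_vec m n a b) \<bullet>c tensor_vec m n a b
      = sform ?G F (prodv (\<lambda>i. a $ i) (\<lambda>i. b $ i)) (prodv (\<lambda>i. a $ i) (\<lambda>i. b $ i))"
      unfolding mat_form_sform[OF W t t] by (rule sform_cong) (simp_all add: FW tensor_vec_prodv)
    then show ?thesis using F_prod by simp
  qed
  moreover have "\<exists>r::real. r < 0 \<and> eigenvalue W (complex_of_real r)"
  proof -
    \<comment> \<open>The negative pairing is a sum of values of \<open>F\<close> on Gram vectors of
      \<rho>, so one of these values is negative, and the lowest eigenvalue with it.\<close>
    obtain k :: nat and v where v: "\<forall>i\<in>?G. \<forall>j\<in>?G. mat_fun n \<rho> i j = (\<Sum>l<k. v l i * cnj (v l j))"
      using psd_on_gram_decomposition[OF finite_grid psd_on_mat_fun[OF \<rho>(2)]] by blast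
    have "tr_prod ?G F (mat_fun n \<rho>) = (\<Sum>l<k. sform ?G F (v l) (v l))"
      by (rule tr_prod_gram) (use v in blast)
    then have sneg: "(\<Sum>l<k. Re (sform ?G F (v l) (v l))) < 0" using neg by simp
    have "\<not> (\<forall>l<k. 0 \<le> Re (sform ?G F (v l) (v l)))"
    proof
      assume "\<forall>l<k. 0 \<le> Re (sform ?G F (v l) (v l))"
      then have "0 \<le> (\<Sum>l<k. Re (sform ?G F (v l) (v l)))" by (intro sum_nonneg) simp
      then show False using sneg by simp
    qed
    then obtain l where l: "Re (sform ?G F (v l) (v l)) < 0" by (auto simp: not_le)
    obtain r :: real and x where r: "r < 0" "\<exists>i\<in>?G. x i \<noteq> 0" "\<And>i. i \<in> ?G \<Longrightarrow> (\<Sum>j\<in>?G. F i j * x j) = complex_of_real r * x i"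
      by (rule negative_eigenvector[OF finite_grid FH l]) (rule that)
    define u where "u = Matrix.vec (m * n) (\<lambda>k. x (k div n, k mod n))"
    have u: "u \<in> carrier_vec (m * n)" by (simp add: u_def)
    have ux: "u $ (fst i * n + snd i) = x i" if "i \<in> ?G" for i
      by (simp only: u_def index_vec[OF grid_index_less[OF that]] grid_index_pair[OF that])
    have "W *\<^sub>v u = complex_of_real r \<cdot>\<^sub>v u"
    proof (intro eq_vecI)
      fix k assume "k < dim_vec (complex_of_real r \<cdot>\<^sub>v u)"
      then have k: "k < m * n" by (simp add: u_def)
      have "(W *\<^sub>v u) $ k = (\<Sum>l<m * n. W $$ (k, l) * u $ l)"
        using k W u by (auto simp: scalar_prod_def atLeast0LessThan intro!: sum.cong)
      also have "\<dots> = (\<Sum>j\<in>?G. F (k div n, k mod n) j * x j)"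
        unfolding sum_index_grid
      proof (rule sum.cong[OF refl])
        fix j assume j: "j \<in> ?G"
        have "W $$ (k, fst j * n + snd j) = F (k div n, k mod n) j"
          by (simp only: W_def index_mat(1)[OF k grid_index_less[OF j]] prod.case grid_index_pair[OF j])
        then show "W $$ (k, fst j * n + snd j) * u $ (fst j * n + snd j) = F (k div n, k mod n) j * x j"
          by (simp only: ux[OF j])
      qed
      also have "\<dots> = complex_of_real r * x (k div n, k mod n)"
        by (rule r(3)) (rule div_mod_in_grid[OF k])
      finally show "(W *\<^sub>v u) $ k = (complex_of_real r \<cdot>\<^sub>v u) $ k"
        using k by (simp add: u_def)
    qed (use W u in simp)
    moreover have "u \<noteq> 0\<^sub>v (m * n)"
    proof
      assume "u = 0\<^sub>v (m * n)"
      then have "x i = 0" if "i \<in> ?G" for i using ux[OF that] that by (simp add: grid_index_less)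
      then show False using r(2) by blast
    qed
    ultimately have "eigenvector W u (complex_of_real r)"
      using W u by (simp add: eigenvector_def)
    then show ?thesis using r(1) unfolding eigenvalue_def by blast
  qed
  ultimately have "entanglement_witness m n W"
    by (simp add: entanglement_witness_def)
  moreover have "\<not> decomposable m n W"
  proof
    assume "decomposable m n W"
    then obtain P Q where PQ: "psd (m * n) P" "psd (m * n) Q" "W = P + ptrans m n Q"
      unfolding decomposable_def by blast
    have dim: "P \<in> carrier_mat (m * n) (m * n)" "ptrans m n Q \<in> carrier_mat (m * n) (m * n)"
      using PQ(1) unfolding psd_def hermitian_def by (blast, simp add: ptrans_def)
    have "F i j = mat_fun n P i j + pt (mat_fun n Q) i j" if "i \<in> ?G" "j \<in> ?G" for i j
      unfolding FW[OF that, symmetric] mat_fun_ptrans[OF that, symmetric] PQ(3)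
      using dim that by (simp add: mat_fun_def grid_index_less)
    then have "tr_prod ?G F Y = tr_prod ?G (\<lambda>i j. mat_fun n P i j + pt (mat_fun n Q) i j) Y"
      unfolding tr_prod_def by (intro sum.cong refl) simp
    also have "\<dots> = tr_prod ?G (mat_fun n P) Y + tr_prod ?G (mat_fun n Q) (pt Y)"
      by (simp add: tr_prod_add_left tr_prod_pt)
    finally have "0 \<le> Re (tr_prod ?G F Y)"
      using tr_prod_psd_nonneg[OF finite_grid psd_on_mat_fun[OF PQ(1)] Y(1)]
        tr_prod_psd_nonneg[OF finite_grid psd_on_mat_fun[OF PQ(2)] Y(2)] by simp
    then show False using FY by simp
  qed
  moreover have "Re (mtrace (W * \<rho>)) < 0"
    using neg by (simp add: mtrace_mult[OF W \<rho>(3)] trW)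
  ultimately show ?thesis by blast
qed

end
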